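(* If a finite graph $G$ is opt-in, then any minor of $G$ is also opt-in.
   Context: Graphs are finite and may have loops and parallel edges. Fix an arbitrary orientation of a graph $G$, giving a digraph $D$ with arc set $A(D)$ (the notions below do not depend on the orientation). A cycle is a closed walk (at least one arc, arcs pairwise distinct, arcs may be traversed in either direction) with distinct vertices except that the first equals the last; its incidence vector in $\{0,\pm1\}^{A(D)}$ has entry $1$ (resp. $-1$) on arcs traversed forward (resp. backward). The cycle space $\mathcal C_{\mathbb R}(D)$ is the set of $x\in\mathbb R^{A(D)}$ satisfying flow conservation at every vertex. A directed cycle basis is a basis of $\mathcal C_{\mathbb R}(D)$ consisting of incidence vectors of cycles (which may traverse arcs in either direction). It is integral if every cycle is an integer linear combination of its members. For $w:A(D)\to\mathbb R_{\ge0}$, a cycle has weight $w(C)=\sum_{e\in C}w(e)$ and a basis has weight $w(\mathcal B)=\sum_{C\in\mathcal B}w(C)$; minimum bases are those of minimum weight in the respective class. A graph is opt-in if for every weight $w\ge 0$ the weight of a minimum directed cycle basis equals the weight of a minimum integral cycle basis; otherwise it is opt-out. A minor of $G$ is a graph obtained from $G$ by a sequence of edge deletions, vertex deletions and contractions of (non-loop) edges. *)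

theory Defs
  imports
    Complex_Main
    "HOL-Library.Function_Algebras"
    "HOL-Library.Uprod"
    "Graph_Theory.Arc_Walk"
begin

section \<open>Finite multigraphs and their minors\<close>

text \<open>
  An unordered pair \<^term>\<open>Upair u v\<close> may have \<^term>\<open>u = v\<close>, so loops as well as parallel
  edges are allowed. The map \<open>ends\<close> is only meaningful on \<open>edges\<close>.
\<close>

record ('v, 'e) multigraph =
  vertices :: "'v set"
  edges :: "'e set"
  ends :: "'e \<Rightarrow> 'v uprod"

definition finite_graph :: "('v, 'e) multigraph \<Rightarrow> bool" where
  "finite_graph G \<longleftrightarrow> finite (vertices G) \<and> finite (edges G) \<and>
     (\<forall>e\<in>edges G. set_uprod (ends G e) \<subseteq> vertices G)"

definition delete_edge :: "'e \<Rightarrow> ('v, 'e) multigraph \<Rightarrow> ('v, 'e) multigraph" where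
  "delete_edge e G = \<lparr>vertices = vertices G, edges = edges G - {e}, ends = ends G\<rparr>"

definition delete_vertex :: "'v \<Rightarrow> ('v, 'e) multigraph \<Rightarrow> ('v, 'e) multigraph" where
  "delete_vertex v G =
     \<lparr>vertices = vertices G - {v},
      edges = {e \<in> edges G. v \<notin> set_uprod (ends G e)},
      ends = ends G\<rparr>"

text \<open>
  Contraction of \<open>e\<close>: the ends of \<open>e\<close> are identified to a single vertex, which is called \<open>w\<close>,
  and \<open>e\<close> disappears. Edges parallel to \<open>e\<close> become loops.
\<close>

definition contract_edge :: "'e \<Rightarrow> 'v \<Rightarrow> ('v, 'e) multigraph \<Rightarrow> ('v, 'e) multigraph" where
  "contract_edge e w G =
     \<lparr>vertices = insert w (vertices G - set_uprod (ends G e)),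
      edges = edges G - {e},
      ends = (\<lambda>f. map_uprod (\<lambda>x. if x \<in> set_uprod (ends G e) then w else x) (ends G f))\<rparr>"

text \<open>
  The vertex resulting from a contraction may be given any name not already used by a
  remaining vertex; in particular it may be one of the two ends of the contracted edge.
\<close>

inductive minor_step :: "('v, 'e) multigraph \<Rightarrow> ('v, 'e) multigraph \<Rightarrow> bool" where
  edge_deletion: "e \<in> edges G \<Longrightarrow> minor_step G (delete_edge e G)"
| vertex_deletion: "v \<in> vertices G \<Longrightarrow> minor_step G (delete_vertex v G)"
| edge_contraction: "e \<in> edges G \<Longrightarrow> proper_uprod (ends G e) \<Longrightarrow>
    w \<notin> vertices G - set_uprod (ends G e) \<Longrightarrow> minor_step G (contract_edge e w G)"

definition minor_of :: "('v, 'e) multigraph \<Rightarrow> ('v, 'e) multigraph \<Rightarrow> bool" where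
  "minor_of H G \<longleftrightarrow> minor_step\<^sup>*\<^sup>* G H"


section \<open>Orientations, cycles and the cycle space\<close>

definition orientation_of :: "('v, 'e) pre_digraph \<Rightarrow> ('v, 'e) multigraph \<Rightarrow> bool" where
  "orientation_of D G \<longleftrightarrow> verts D = vertices G \<and> arcs D = edges G \<and>
     (\<forall>e\<in>edges G. Upair (tail D e) (head D e) = ends G e)"

text \<open>
  The arc \<open>(e, True)\<close> of \<open>traversals D\<close> is \<open>e\<close> traversed forward, \<open>(e, False)\<close> is \<open>e\<close> traversed
  backward. Walks in \<open>D\<close> that may use arcs in either direction are the directed walks
  of \<open>traversals D\<close>.
\<close>

definition traversals :: "('v, 'e) pre_digraph \<Rightarrow> ('v, 'e \<times> bool) pre_digraph" where
  "traversals D =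
     \<lparr>verts = verts D,
      arcs = arcs D \<times> UNIV,
      tail = (\<lambda>(e, fwd). if fwd then tail D e else head D e),
      head = (\<lambda>(e, fwd). if fwd then head D e else tail D e)\<rparr>"

text \<open>
  \<^const>\<open>pre_digraph.cycle\<close> requires a nonempty closed walk without repeated vertices (except that
  first and last vertex agree). Distinctness of the underlying arcs only excludes going back and forth
  along one arc; cycles of length 1 (loops) and 2 (parallel arcs) remain.
\<close>

definition is_cycle :: "('v, 'e) pre_digraph \<Rightarrow> ('e \<times> bool) list \<Rightarrow> bool" where
  "is_cycle D p \<longleftrightarrow> pre_digraph.cycle (traversals D) p \<and> distinct (map fst p)"

text \<open>
  Vectors in $\mathbb R^{A(D)}$ are functions on the type of arcs that vanish outside \<^term>\<open>arcs D\<close>.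
\<close>

definition incidence_vector :: "('e \<times> bool) list \<Rightarrow> 'e \<Rightarrow> real" where
  "incidence_vector p =
     (\<lambda>e. if (e, True) \<in> set p then 1 else if (e, False) \<in> set p then - 1 else 0)"

definition cycle_vectors :: "('v, 'e) pre_digraph \<Rightarrow> ('e \<Rightarrow> real) set" where
  "cycle_vectors D = {incidence_vector p | p. is_cycle D p}"

definition cycle_space :: "('v, 'e) pre_digraph \<Rightarrow> ('e \<Rightarrow> real) set" where
  "cycle_space D = {x. (\<forall>e. e \<notin> arcs D \<longrightarrow> x e = 0) \<and>
     (\<forall>v\<in>verts D. (\<Sum>e\<in>out_arcs D v. x e) = (\<Sum>e\<in>in_arcs D v. x e))}"

definition scale_fun :: "real \<Rightarrow> ('e \<Rightarrow> real) \<Rightarrow> 'e \<Rightarrow> real" where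
  "scale_fun c x = (\<lambda>e. c * x e)"

global_interpretation arc_space: vector_space "scale_fun :: real \<Rightarrow> ('e \<Rightarrow> real) \<Rightarrow> 'e \<Rightarrow> real"
  by unfold_locales (auto simp: scale_fun_def algebra_simps fun_eq_iff)


section \<open>Cycle bases\<close>

definition directed_cycle_basis :: "('v, 'e) pre_digraph \<Rightarrow> ('e \<Rightarrow> real) set \<Rightarrow> bool" where
  "directed_cycle_basis D B \<longleftrightarrow>
     B \<subseteq> cycle_vectors D \<and> arc_space.independent B \<and> arc_space.span B = cycle_space D"

definition integral_cycle_basis :: "('v, 'e) pre_digraph \<Rightarrow> ('e \<Rightarrow> real) set \<Rightarrow> bool" where
  "integral_cycle_basis D B \<longleftrightarrow> directed_cycle_basis D B \<and>
     (\<forall>x\<in>cycle_vectors D. \<exists>k :: ('e \<Rightarrow> real) \<Rightarrow> int.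
        x = (\<Sum>b\<in>B. scale_fun (of_int (k b)) b))"

text \<open>The arcs of a cycle are the support of its incidence vector.\<close>

definition cycle_weight :: "('v, 'e) pre_digraph \<Rightarrow> ('e \<Rightarrow> real) \<Rightarrow> ('e \<Rightarrow> real) \<Rightarrow> real" where
  "cycle_weight D w x = (\<Sum>e\<in>{e \<in> arcs D. x e \<noteq> 0}. w e)"

definition basis_weight :: "('v, 'e) pre_digraph \<Rightarrow> ('e \<Rightarrow> real) \<Rightarrow> ('e \<Rightarrow> real) set \<Rightarrow> real" where
  "basis_weight D w B = (\<Sum>x\<in>B. cycle_weight D w x)"

definition minimum_directed_cycle_basis ::
  "('v, 'e) pre_digraph \<Rightarrow> ('e \<Rightarrow> real) \<Rightarrow> ('e \<Rightarrow> real) set \<Rightarrow> bool" where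
  "minimum_directed_cycle_basis D w B \<longleftrightarrow> directed_cycle_basis D B \<and>
     (\<forall>B'. directed_cycle_basis D B' \<longrightarrow> basis_weight D w B \<le> basis_weight D w B')"

definition minimum_integral_cycle_basis ::
  "('v, 'e) pre_digraph \<Rightarrow> ('e \<Rightarrow> real) \<Rightarrow> ('e \<Rightarrow> real) set \<Rightarrow> bool" where
  "minimum_integral_cycle_basis D w B \<longleftrightarrow> integral_cycle_basis D B \<and>
     (\<forall>B'. integral_cycle_basis D B' \<longrightarrow> basis_weight D w B \<le> basis_weight D w B')"

text \<open>
  Minimum bases of the same class have the same weight, so it does not matter which ones are
  compared; the existential form also asserts that they exist.
\<close>

definition opt_in :: "('v, 'e) multigraph \<Rightarrow> bool" where
  "opt_in G \<longleftrightarrow> (\<forall>D. orientation_of D G \<longrightarrow>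
     (\<forall>w :: 'e \<Rightarrow> real. (\<forall>e\<in>edges G. 0 \<le> w e) \<longrightarrow>
        (\<exists>B B'. minimum_directed_cycle_basis D w B \<and> minimum_integral_cycle_basis D w B' \<and>
           basis_weight D w B = basis_weight D w B')))"

lemma ex_orientation: "\<exists>D. orientation_of D G"
proof -
  have "\<exists>p. Upair (fst p) (snd p) = ends G e" for e
    by (cases "ends G e") auto
  then obtain t where "\<And>e. Upair (fst (t e)) (snd (t e)) = ends G e"
    by metis
  then have "orientation_of \<lparr>verts = vertices G, arcs = edges G,
      tail = fst \<circ> t, head = snd \<circ> t\<rparr> G"
    by (simp add: orientation_of_def)
  then show ?thesis ..
qed

lemma finite_graph_minor_step:
  assumes "minor_step G H" and "finite_graph G"
  shows "finite_graph H"
  using assms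
proof cases
  case (edge_deletion e)
  then show ?thesis using assms(2) by (auto simp: finite_graph_def delete_edge_def)
next
  case (vertex_deletion v)
  then show ?thesis using assms(2) by (auto simp: finite_graph_def delete_vertex_def)
next
  case (edge_contraction e w)
  then show ?thesis using assms(2)
    by (auto simp: finite_graph_def contract_edge_def uprod.set_map)
qed

end

theory Submission
  imports Defs "Graph_Theory.Digraph_Component"
begin

text \<open>
  The cycle vectors of a digraph are exactly the elementary vectors (nonzero, entries in
  $\{0,\pm 1\}$, minimal support) of its cycle space, and the cycle space is regular in the sense of
  Tutte: below every nonzero vector there is an elementary one with agreeing signs. Hence opt-in is a
  property of a space of real vectors, and on cycle spaces the minor operations become intersection
  with coordinate hyperplanes and forgetting a coordinate.

  For a deletion, put a prohibitive weight on the deleted edge: a minimum integral basis then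
  has at most one circuit through that edge, and removing this circuit leaves a minimum integral basis
  of the deletion. For a contraction, give the contracted edge weight 0 and make all other weights
  positive by a small perturbation.
\<close>

section \<open>Signed circuits of a space of real vectors\<close>

text \<open>The obstacle in both minor operations is that the transferred basis must again consist
  of circuits. For a deletion, the circuits of the basis through \<open>e\<close> must be confined
  to one member; it can then be dropped without disturbing the integer expansions in the rest. For a
  contraction, a cycle with chord \<open>e\<close> stops being a circuit, since it splits at the
  contracted vertex. With weight 0 on \<open>e\<close>, both parts of such a cycle are available
  before the contraction at no extra cost, and one of them can replace it in the basis; positive
  weights elsewhere make this exchange strictly cheaper, hence impossible in a minimum basis. In the
  other direction regularity suffices: every circuit of a contraction lifts to a circuit, so
  competing bases lift with equal weight. Opt-in speaks of all orientations, so each orientation of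
  a minor is first lifted to one of the larger graph.\<close>

definition supp :: "('e \<Rightarrow> real) \<Rightarrow> 'e set" where
  "supp x = {i. x i \<noteq> 0}"

definition signed_circuits :: "('e \<Rightarrow> real) set \<Rightarrow> ('e \<Rightarrow> real) set" where
  "signed_circuits V = {x \<in> V. x \<noteq> 0 \<and> range x \<subseteq> {- 1, 0, 1} \<and>
     (\<forall>y\<in>V. y \<noteq> 0 \<longrightarrow> supp y \<subseteq> supp x \<longrightarrow> supp y = supp x)}"

text \<open>The set \<open>E\<close> bounds all supports because the type of coordinates may be
  infinite. The inequality \<open>0 < c i * x i\<close> encodes both \<open>supp c\<close> inside
  \<open>supp x\<close> and agreement of signs.\<close>

definition regular_space :: "('e \<Rightarrow> real) set \<Rightarrow> bool" where
  "regular_space V \<longleftrightarrow> arc_space.subspace V \<and> (\<exists>E. finite E \<and> (\<forall>x\<in>V. supp x \<subseteq> E)) \<and>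
     (\<forall>x\<in>V. x \<noteq> 0 \<longrightarrow> (\<exists>c\<in>signed_circuits V. \<forall>i. c i \<noteq> 0 \<longrightarrow> 0 < c i * x i))"

definition circuit_basis :: "('e \<Rightarrow> real) set \<Rightarrow> ('e \<Rightarrow> real) set \<Rightarrow> bool" where
  "circuit_basis V B \<longleftrightarrow>
     B \<subseteq> signed_circuits V \<and> arc_space.independent B \<and> arc_space.span B = V"

definition integral_circuit_basis :: "('e \<Rightarrow> real) set \<Rightarrow> ('e \<Rightarrow> real) set \<Rightarrow> bool" where
  "integral_circuit_basis V B \<longleftrightarrow> circuit_basis V B \<and>
     (\<forall>x\<in>signed_circuits V. \<exists>k :: ('e \<Rightarrow> real) \<Rightarrow> int. x = (\<Sum>b\<in>B. scale_fun (of_int (k b)) b))"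

definition supp_weight :: "('e \<Rightarrow> real) \<Rightarrow> ('e \<Rightarrow> real) \<Rightarrow> real" where
  "supp_weight w x = (\<Sum>i\<in>supp x. w i)"

definition total_weight :: "('e \<Rightarrow> real) \<Rightarrow> ('e \<Rightarrow> real) set \<Rightarrow> real" where
  "total_weight w B = (\<Sum>x\<in>B. supp_weight w x)"

text \<open>Integral bases are special circuit bases, so equality of the two minima means that a
  single integral basis attains the minimum over all circuit bases. This form involves one basis
  instead of two.\<close>

definition integrally_optimal :: "('e \<Rightarrow> real) set \<Rightarrow> bool" where
  "integrally_optimal V \<longleftrightarrow> (\<forall>w. (\<forall>i. 0 \<le> w i) \<longrightarrow>
     (\<exists>B. integral_circuit_basis V B \<and>
       (\<forall>B'. circuit_basis V B' \<longrightarrow> total_weight w B \<le> total_weight w B')))"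

lemma sum_fun_apply: "(\<Sum>b\<in>B. f b) i = (\<Sum>b\<in>B. f b i)"
  for f :: "'b \<Rightarrow> 'a \<Rightarrow> real"
  by (induction B rule: infinite_finite_induct) auto

lemma scale_fun_apply [simp]: "scale_fun c x i = c * x i"
  by (simp add: scale_fun_def)

lemma mem_supp [simp]: "i \<in> supp x \<longleftrightarrow> x i \<noteq> 0"
  by (simp add: supp_def)

lemma supp_eq_empty_iff [simp]: "supp x = {} \<longleftrightarrow> x = 0"
  by (auto simp: fun_eq_iff supp_def)

lemma finite_signed_circuits:
  assumes "finite E" "\<And>x. x \<in> V \<Longrightarrow> supp x \<subseteq> E"
  shows "finite (signed_circuits V)"
proof (rule finite_subset)
  show "signed_circuits V \<subseteq> {x. \<forall>i. (i \<in> E \<longrightarrow> x i \<in> {- 1, 0, 1}) \<and> (i \<notin> E \<longrightarrow> x i = 0)}"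
  proof (intro subsetI CollectI allI conjI impI)
    fix x i assume x: "x \<in> signed_circuits V"
    show "x i \<in> {- 1, 0, 1}"
      using x rangeI[of x i] unfolding signed_circuits_def by blast
    show "x i = 0" if "i \<notin> E"
      using x assms(2)[of x] that by (auto simp: signed_circuits_def)
  qed
  show "finite {x. \<forall>i. (i \<in> E \<longrightarrow> x i \<in> {- 1, 0, 1::real}) \<and> (i \<notin> E \<longrightarrow> x i = 0)}"
    using assms(1) by (intro finite_set_of_finite_funs) auto
qed

lemma circuit_basisD:
  assumes "circuit_basis V B"
  shows "B \<subseteq> signed_circuits V" "B \<subseteq> V" "arc_space.independent B" "arc_space.span B = V"
  using assms by (auto simp: circuit_basis_def signed_circuits_def)

lemma circuit_basis_finite:
  assumes "regular_space V" "circuit_basis V B"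
  shows "finite B"
  using assms finite_signed_circuits[of _ V] finite_subset
  by (metis circuit_basisD(1) regular_space_def)

lemma regular_space_finite_supp:
  assumes "regular_space V" "x \<in> V"
  shows "finite (supp x)"
  using assms by (meson finite_subset regular_space_def)

lemma regular_space_subspace: "regular_space V \<Longrightarrow> arc_space.subspace V"
  by (simp add: regular_space_def)

text \<open>Subtracting a multiple of a conformal circuit removes a coordinate from the support and
  adds none, so induction on the size of the support applies.\<close>

lemma regular_space_in_span:
  assumes V: "regular_space V" and "x \<in> V"
  shows "x \<in> arc_space.span {c \<in> signed_circuits V. supp c \<subseteq> supp x}"
  using \<open>x \<in> V\<close>
proof (induction "card (supp x)" arbitrary: x rule: less_induct)
  case less
  have sub: "arc_space.subspace V"
    using V by (rule regular_space_subspace)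
  show ?case
  proof (cases "x = 0")
    case True
    then show ?thesis by (simp add: arc_space.span_zero)
  next
    case False
    then obtain c where c: "c \<in> signed_circuits V" "\<And>i. c i \<noteq> 0 \<Longrightarrow> 0 < c i * x i"
      using V less.prems by (auto simp: regular_space_def)
    have cV: "c \<in> V" "c \<noteq> 0"
      using c(1) by (auto simp: signed_circuits_def)
    then obtain f where f: "c f \<noteq> 0"
      by (auto simp: fun_eq_iff)
    have cx: "supp c \<subseteq> supp x"
      using c(2) by force
    \<comment> \<open>The factor is chosen to cancel coordinate \<open>f\<close>.\<close>
    define y where "y = x - scale_fun (x f / c f) c"
    have yV: "y \<in> V"
      unfolding y_def using sub less.prems cV
      by (intro arc_space.subspace_diff arc_space.subspace_scale)
    have "supp y \<subseteq> supp x - {f}"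
      using cx f by (auto simp: y_def subset_iff)
    moreover have "f \<in> supp x"
      using cx f by auto
    ultimately have psub: "supp y \<subset> supp x"
      by blast
    then have "card (supp y) < card (supp x)"
      using regular_space_finite_supp[OF V less.prems] by (rule psubset_card_mono[rotated])
    then have "y \<in> arc_space.span {c \<in> signed_circuits V. supp c \<subseteq> supp y}"
      using less.hyps yV by blast
    then have "y \<in> arc_space.span {c \<in> signed_circuits V. supp c \<subseteq> supp x}"
      using psub arc_space.span_mono[of "{c \<in> signed_circuits V. supp c \<subseteq> supp y}"
          "{c \<in> signed_circuits V. supp c \<subseteq> supp x}"] by blast
    moreover have "scale_fun (x f / c f) c \<in> arc_space.span {c \<in> signed_circuits V. supp c \<subseteq> supp x}"
      using c(1) cx by (intro arc_space.span_scale arc_space.span_base) auto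
    ultimately have "y + scale_fun (x f / c f) c
        \<in> arc_space.span {c \<in> signed_circuits V. supp c \<subseteq> supp x}"
      by (rule arc_space.span_add)
    then show ?thesis by (simp add: y_def)
  qed
qed

lemma regular_space_span_eq:
  assumes "regular_space V"
  shows "arc_space.span (signed_circuits V) = V"
proof
  show "arc_space.span (signed_circuits V) \<subseteq> V"
    using assms by (intro arc_space.span_minimal) (auto simp: signed_circuits_def regular_space_def)
  show "V \<subseteq> arc_space.span (signed_circuits V)"
    using regular_space_in_span[OF assms]
      arc_space.span_mono[of "{c \<in> signed_circuits V. supp c \<subseteq> supp x}" "signed_circuits V" for x]
    by blast
qed

lemma ex_circuit_basis:
  assumes "regular_space V"
  obtains B where "circuit_basis V B"
proof -
  obtain B where B: "B \<subseteq> signed_circuits V" "arc_space.independent B"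
      "signed_circuits V \<subseteq> arc_space.span B"
    by (rule arc_space.maximal_independent_subset)
  then have "arc_space.span B = arc_space.span (signed_circuits V)"
    by (metis arc_space.span_eq arc_space.span_superset subset_trans)
  then have "circuit_basis V B"
    using B regular_space_span_eq[OF assms] by (simp add: circuit_basis_def)
  then show thesis by (rule that)
qed

text \<open>The circuits inside \<open>supp x\<close> span \<open>x\<close>, so they cannot all lie
  in \<open>W\<close>. This yields a circuit through a deleted element, and later the circuit for a
  basis exchange.\<close>

lemma regular_space_circuit_notin_subspace:
  assumes V: "regular_space V" and "x \<in> V" "arc_space.subspace W" "x \<notin> W"
  obtains c where "c \<in> signed_circuits V" "supp c \<subseteq> supp x" "c \<notin> W"
proof -
  have "\<not> {c \<in> signed_circuits V. supp c \<subseteq> supp x} \<subseteq> W"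
    using regular_space_in_span[OF V \<open>x \<in> V\<close>] arc_space.span_minimal[OF _ assms(3)] assms(4)
    by (meson subsetD)
  then show thesis using that by blast
qed

text \<open>Steinitz exchange: the expansion of \<open>c\<close> in \<open>B\<close> must involve
  \<open>C\<close>, so \<open>C\<close> can be recovered from \<open>c\<close> and the other
  members.\<close>

lemma circuit_basis_exchange:
  assumes V: "regular_space V" and B: "circuit_basis V B" and "C \<in> B"
    and c: "c \<in> signed_circuits V" "c \<notin> arc_space.span (B - {C})"
  shows "circuit_basis V (insert c (B - {C}))"
proof -
  note Bd = circuit_basisD[OF B]
  have sub: "arc_space.subspace V" using V by (rule regular_space_subspace)
  have cV: "c \<in> V" using c by (auto simp: signed_circuits_def)
  have ins: "insert C (B - {C}) = B" using \<open>C \<in> B\<close> by auto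
  have "C \<in> arc_space.span (insert c (B - {C}))"
    using arc_space.in_span_insert[of c C "B - {C}"] c(2) cV Bd(4) ins by simp
  moreover have "x \<in> arc_space.span (insert c (B - {C}))" if "x \<in> B - {C}" for x
    using that by (intro arc_space.span_base) simp
  ultimately have "B \<subseteq> arc_space.span (insert c (B - {C}))"
    by blast
  then have "V \<subseteq> arc_space.span (insert c (B - {C}))"
    using Bd(4) by (metis arc_space.span_minimal arc_space.subspace_span)
  moreover have "arc_space.span (insert c (B - {C})) \<subseteq> V"
    using Bd(2) cV sub by (intro arc_space.span_minimal) auto
  moreover have "arc_space.independent (insert c (B - {C}))"
    using c(2) Bd(3) by (meson Diff_subset arc_space.independent_insertI arc_space.independent_mono)
  ultimately show ?thesis
    using Bd(1) c(1) by (auto simp: circuit_basis_def)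
qed

lemma supp_weight_nonneg: "(\<And>i. 0 \<le> w i) \<Longrightarrow> 0 \<le> supp_weight w x"
  by (simp add: supp_weight_def sum_nonneg)

lemma total_weight_nonneg: "(\<And>i. 0 \<le> w i) \<Longrightarrow> 0 \<le> total_weight w B"
  by (simp add: total_weight_def sum_nonneg supp_weight_nonneg)

lemma supp_weight_upd_zero: "x e = 0 \<Longrightarrow> supp_weight (w(e := M)) x = supp_weight w x"
  unfolding supp_weight_def by (rule sum.cong) auto

lemma total_weight_upd_zero:
  "(\<And>x. x \<in> B \<Longrightarrow> x e = 0) \<Longrightarrow> total_weight (w(e := M)) B = total_weight w B"
  unfolding total_weight_def by (rule sum.cong) (auto simp: supp_weight_upd_zero)

section \<open>Deletion\<close>

text \<open>Every vector supported inside \<open>supp x\<close> vanishes at \<open>e\<close>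
  together with \<open>x\<close>, so minimality of the support means the same in both
  spaces.\<close>

lemma signed_circuits_deletion:
  "signed_circuits {x \<in> V. x e = 0} = {c \<in> signed_circuits V. c e = 0}" (is "?L = ?R")
proof
  show "?L \<subseteq> ?R"
  proof
    fix x assume x: "x \<in> ?L"
    then have "y e = 0" if "supp y \<subseteq> supp x" for y
      using that by (auto simp: signed_circuits_def)
    then show "x \<in> ?R"
      using x by (auto simp: signed_circuits_def)
  qed
  show "?R \<subseteq> ?L"
    by (auto simp: signed_circuits_def)
qed

text \<open>A circuit agreeing in sign with \<open>x\<close> vanishes wherever \<open>x\<close>
  does, so the conformal circuits of \<open>V\<close> already lie in the hyperplane.\<close>

lemma regular_space_deletion:
  assumes "regular_space V"
  shows "regular_space {x \<in> V. x e = 0}"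
proof -
  have "arc_space.subspace {x \<in> V. x e = 0}"
    using regular_space_subspace[OF assms]
    by (auto simp: arc_space.subspace_def)
  moreover have "\<exists>E. finite E \<and> (\<forall>x\<in>{x \<in> V. x e = 0}. supp x \<subseteq> E)"
    using assms unfolding regular_space_def by (elim conjE exE) (intro exI conjI, auto)
  moreover have "\<exists>c\<in>signed_circuits {x \<in> V. x e = 0}. \<forall>i. c i \<noteq> 0 \<longrightarrow> 0 < c i * x i"
    if x: "x \<in> {x \<in> V. x e = 0}" "x \<noteq> 0" for x
  proof -
    obtain c where "c \<in> signed_circuits V" "\<forall>i. c i \<noteq> 0 \<longrightarrow> 0 < c i * x i"
      using assms x unfolding regular_space_def by auto
    moreover from this have "c e = 0"
      using x by force
    ultimately show ?thesis
      unfolding signed_circuits_deletion by blast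
  qed
  ultimately show ?thesis
    unfolding regular_space_def by blast
qed

text \<open>The hyperplane has codimension 1 once some circuit is nonzero at \<open>e\<close>: a
  multiple of \<open>c\<close> clears coordinate \<open>e\<close> of any vector.\<close>

lemma circuit_basis_insert_deletion:
  assumes V: "regular_space V" and B: "circuit_basis {x \<in> V. x e = 0} B"
    and c: "c \<in> signed_circuits V" "c e \<noteq> 0"
  shows "circuit_basis V (insert c B)" "c \<notin> B"
proof -
  note Bd = circuit_basisD[OF B]
  show "c \<notin> B" using Bd(2) c(2) by auto
  have sub: "arc_space.subspace V" using V by (rule regular_space_subspace)
  have cV: "c \<in> V" using c by (auto simp: signed_circuits_def)
  have "x \<in> arc_space.span (insert c B)" if "x \<in> V" for x
  proof -
    have "x - scale_fun (x e / c e) c \<in> {x \<in> V. x e = 0}"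
      using sub that cV c(2) by (auto intro: arc_space.subspace_diff arc_space.subspace_scale)
    then show ?thesis
      unfolding arc_space.span_breakdown_eq using Bd(4) by blast
  qed
  moreover have "arc_space.span (insert c B) \<subseteq> V"
    using Bd(2) cV sub by (intro arc_space.span_minimal) auto
  moreover have "arc_space.independent (insert c B)"
    using Bd(3,4) c(2) by (intro arc_space.independent_insertI) auto
  ultimately show "circuit_basis V (insert c B)"
    using Bd(1) c(1) unfolding signed_circuits_deletion by (auto simp: circuit_basis_def)
qed

lemma integrally_optimal_deletion:
  assumes V: "regular_space V" and opt: "integrally_optimal V"
  shows "integrally_optimal {x \<in> V. x e = 0}"
proof (cases "{x \<in> V. x e = 0} = V")
  \<comment> \<open>Here coordinate \<open>e\<close> is identically zero on \<open>V\<close>; for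
    graphs, \<open>e\<close> lies on no cycle.\<close>
  case True
  then show ?thesis using opt by simp
next
  case False
  define V' where "V' = {x \<in> V. x e = 0}"
  have V': "regular_space V'"
    unfolding V'_def using V by (rule regular_space_deletion)
  have sub': "arc_space.subspace V'" using V' by (rule regular_space_subspace)
  obtain x where "x \<in> V" "x \<notin> V'" using False V'_def by blast
  then obtain c0 where "c0 \<in> signed_circuits V" "c0 \<notin> V'"
    using regular_space_circuit_notin_subspace[OF V _ sub'] by metis
  then have c0: "c0 \<in> signed_circuits V" "c0 e \<noteq> 0"
    by (auto simp: V'_def signed_circuits_def)
  obtain B0 where B0: "circuit_basis V' B0" using ex_circuit_basis[OF V'] .
  show ?thesis
    unfolding integrally_optimal_def V'_def[symmetric]
  proof (intro allI impI)
    fix w :: "'a \<Rightarrow> real" assume w: "\<forall>i. 0 \<le> w i"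
    \<comment> \<open>Two circuits through \<open>e\<close> cost at least \<open>M + M\<close>,
      while the basis \<open>insert c0 B0\<close> costs at most
      \<open>M + supp_weight w c0 + total_weight w B0\<close>, which is
      \<open>M + M - 1\<close>.\<close>
    define M where "M = 1 + total_weight w B0 + supp_weight w c0"
    have M: "0 < M"
      using w total_weight_nonneg[of w B0] supp_weight_nonneg[of w c0] by (simp add: M_def)
    define w' where "w' = w(e := M)"
    have w': "0 \<le> w' i" for i using w M by (simp add: w'_def)
    have eq': "supp_weight w' x = supp_weight w x" if "x e = 0" for x
      unfolding w'_def using that by (rule supp_weight_upd_zero)
    have eqB': "total_weight w' B = total_weight w B" if "B \<subseteq> V'" for B
      unfolding w'_def using that by (intro total_weight_upd_zero) (auto simp: V'_def)
    have heavy: "M \<le> supp_weight w' x" if "x \<in> V" "x e \<noteq> 0" for x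
    proof -
      have "w' e \<le> supp_weight w' x"
        unfolding supp_weight_def
        using that w' regular_space_finite_supp[OF V] by (intro member_le_sum) auto
      then show ?thesis by (simp add: w'_def)
    qed
    have c0w: "supp_weight w' c0 \<le> M + supp_weight w c0"
    proof -
      have fin: "finite (supp c0)"
        using regular_space_finite_supp[OF V] c0 by (simp add: signed_circuits_def)
      have "supp_weight w' c0 = M + sum w' (supp c0 - {e})"
        unfolding supp_weight_def using fin c0(2) by (subst sum.remove[of _ e]) (auto simp: w'_def)
      also have "sum w' (supp c0 - {e}) = sum w (supp c0 - {e})"
        by (rule sum.cong) (auto simp: w'_def)
      also have "sum w (supp c0 - {e}) \<le> supp_weight w c0"
        unfolding supp_weight_def using fin w by (intro sum_mono2) auto
      finally show ?thesis by simp
    qed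
    obtain B where B: "integral_circuit_basis V B"
      and Bmin: "\<And>B'. circuit_basis V B' \<Longrightarrow> total_weight w' B \<le> total_weight w' B'"
      using opt w' unfolding integrally_optimal_def by blast
    have BV: "circuit_basis V B" using B by (simp add: integral_circuit_basis_def)
    note Bd = circuit_basisD[OF BV]
    have finB: "finite B" using circuit_basis_finite[OF V BV] .
    have "\<not> B \<subseteq> V'"
      using arc_space.span_minimal[OF _ sub'] Bd(4) \<open>x \<in> V\<close> \<open>x \<notin> V'\<close> by blast
    then obtain C where C: "C \<in> B" "C e \<noteq> 0"
      using Bd(2) by (auto simp: V'_def)
    have CV: "C \<in> signed_circuits V" "C \<in> V" using C Bd by auto
    have fin0: "finite B0" using circuit_basis_finite[OF V' B0] .
    have rest: "x e = 0" if "x \<in> B - {C}" for x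
    proof (rule ccontr)
      assume "x e \<noteq> 0"
      have "M + M \<le> supp_weight w' C + supp_weight w' x"
        using heavy[of C] heavy[of x] C CV that Bd(2) \<open>x e \<noteq> 0\<close> by (intro add_mono) auto
      also have "\<dots> = total_weight w' {C, x}"
        using that by (subst insert_commute) (simp add: total_weight_def add.commute)
      also have "\<dots> \<le> total_weight w' B"
        unfolding total_weight_def using finB C that w'
        by (intro sum_mono2) (auto simp: supp_weight_nonneg)
      also have "\<dots> \<le> total_weight w' (insert c0 B0)"
        using circuit_basis_insert_deletion(1)[OF V B0[unfolded V'_def] c0] by (rule Bmin)
      also have "\<dots> = supp_weight w' c0 + total_weight w B0"
        using circuit_basis_insert_deletion(2)[OF V B0[unfolded V'_def] c0] fin0
          eqB'[OF circuit_basisD(2)[OF B0]] by (simp add: total_weight_def)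
      also have "\<dots> < M + M"
        using c0w by (simp add: M_def)
      finally show False by simp
    qed
    define B1 where "B1 = B - {C}"
    have B1V: "B1 \<subseteq> V'" using rest Bd(2) by (auto simp: B1_def V'_def)
    then have spanB1: "arc_space.span B1 \<subseteq> V'"
      using sub' by (rule arc_space.span_minimal)
    have "V' \<subseteq> arc_space.span B1"
    proof
      fix x assume x: "x \<in> V'"
      then have "x \<in> arc_space.span B" using Bd(4) by (simp add: V'_def)
      then obtain k where k: "x - scale_fun k C \<in> arc_space.span B1"
        using arc_space.span_breakdown[OF C(1)] unfolding B1_def by blast
      then have "x - scale_fun k C \<in> V'" using spanB1 by blast
      \<comment> \<open>Among the members of \<open>B\<close> only \<open>C\<close> is nonzero at
        \<open>e\<close>, so its coefficient is read off from coordinate \<open>e\<close>, which is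
        0 for \<open>x\<close>.\<close>
      then have "k = 0" using x C(2) by (simp add: V'_def)
      then show "x \<in> arc_space.span B1" using k by (simp add: scale_fun_def zero_fun_def[symmetric])
    qed
    moreover have "B1 \<subseteq> signed_circuits V'"
      using Bd(1) rest by (auto simp: V'_def signed_circuits_deletion B1_def)
    moreover have "arc_space.independent B1"
      unfolding B1_def using Bd(3) Diff_subset by (rule arc_space.independent_mono)
    ultimately have basis1: "circuit_basis V' B1"
      using spanB1 by (auto simp: circuit_basis_def)
    have "\<exists>k :: ('a \<Rightarrow> real) \<Rightarrow> int. x = (\<Sum>b\<in>B1. scale_fun (of_int (k b)) b)"
      if "x \<in> signed_circuits V'" for x
    proof -
      have x: "x \<in> signed_circuits V" "x e = 0"
        using that by (auto simp: V'_def signed_circuits_deletion)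
      then obtain k :: "('a \<Rightarrow> real) \<Rightarrow> int" where "x = (\<Sum>b\<in>B. scale_fun (of_int (k b)) b)"
        using B by (auto simp: integral_circuit_basis_def)
      then have k: "x = scale_fun (of_int (k C)) C + (\<Sum>b\<in>B1. scale_fun (of_int (k b)) b)"
        by (simp add: B1_def sum.remove[OF finB C(1)])
      \<comment> \<open>Again coordinate \<open>e\<close> isolates the coefficient of
        \<open>C\<close>: the integer expansion over \<open>B\<close> is already one over
        \<open>B1\<close>.\<close>
      have "(\<Sum>b\<in>B1. scale_fun (of_int (k b)) b) e = 0"
        unfolding sum_fun_apply B1_def by (rule sum.neutral) (simp add: rest)
      then have "of_int (k C) * C e = 0"
        using fun_cong[OF k, of e] x(2) by simp
      then have "k C = 0" using C(2) by simp
      then show ?thesis using k by (auto simp: scale_fun_def zero_fun_def[symmetric])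
    qed
    then have "integral_circuit_basis V' B1"
      using basis1 by (simp add: integral_circuit_basis_def)
    \<comment> \<open>A competitor \<open>B2\<close> is completed to a basis of \<open>V\<close> by
      the same circuit \<open>C\<close>, whose weight then cancels in the comparison.\<close>
    moreover have "total_weight w B1 \<le> total_weight w B2" if B2: "circuit_basis V' B2" for B2
    proof -
      have "supp_weight w' C + total_weight w' B1 = total_weight w' B"
        by (simp add: total_weight_def B1_def sum.remove[OF finB C(1)])
      also have "\<dots> \<le> total_weight w' (insert C B2)"
        using circuit_basis_insert_deletion(1)[OF V B2[unfolded V'_def] CV(1) C(2)] by (rule Bmin)
      also have "\<dots> = supp_weight w' C + total_weight w' B2"
        using circuit_basis_insert_deletion(2)[OF V B2[unfolded V'_def] CV(1) C(2)]
          circuit_basis_finite[OF V' B2] by (simp add: total_weight_def)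
      finally show ?thesis
        using eqB' B1V circuit_basisD(2)[OF B2] by simp
    qed
    ultimately show "\<exists>B. integral_circuit_basis V' B \<and>
        (\<forall>B'. circuit_basis V' B' \<longrightarrow> total_weight w B \<le> total_weight w B')"
      by blast
  qed
qed

text \<open>Deleting a vertex removes all its incident edges, hence several coordinates at
  once.\<close>

lemma integrally_optimal_deletion_set:
  assumes "finite F" "regular_space V" "integrally_optimal V"
  shows "regular_space {x \<in> V. \<forall>e\<in>F. x e = 0} \<and> integrally_optimal {x \<in> V. \<forall>e\<in>F. x e = 0}"
  using assms(1)
proof induction
  case empty
  then show ?case using assms by simp
next
  case (insert e F)
  have eq: "{x \<in> V. \<forall>e\<in>insert e F. x e = 0} = {x \<in> {x \<in> V. \<forall>e\<in>F. x e = 0}. x e = 0}"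
    by auto
  show ?case
    unfolding eq
    using insert.IH by (blast intro: regular_space_deletion integrally_optimal_deletion)
qed

section \<open>Contraction\<close>

lemma linear_upd_zero: "Vector_Spaces.linear scale_fun scale_fun (\<lambda>x :: 'e \<Rightarrow> real. x(e := 0))"
  by unfold_locales (auto simp: fun_eq_iff)

text \<open>If each \<open>b\<close> in \<open>I\<close> were beaten in \<open>f\<close> by some
  element of \<open>X\<close>, it would still be beaten after a small perturbation; as
  \<open>I\<close> is finite, one \<open>\<epsilon>\<close> works for all \<open>b\<close>, against
  \<open>min\<close>.\<close>

lemma minimum_of_perturbed_minima:
  fixes f s :: "'a \<Rightarrow> real"
  assumes fin: "finite I"
    and min: "\<And>\<epsilon>. 0 < \<epsilon> \<Longrightarrow> \<exists>b\<in>I. \<forall>b'\<in>X. f b + \<epsilon> * s b \<le> f b' + \<epsilon> * s b'"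
  shows "\<exists>b\<in>I. \<forall>b'\<in>X. f b \<le> f b'"
proof (rule ccontr)
  assume "\<not> ?thesis"
  then have "\<forall>b\<in>I. \<exists>b'\<in>X. f b' < f b" by (simp add: not_le)
  then obtain c where c: "\<And>b. b \<in> I \<Longrightarrow> c b \<in> X" "\<And>b. b \<in> I \<Longrightarrow> f (c b) < f b"
    by metis
  have "eventually (\<lambda>\<epsilon>. f (c b) + \<epsilon> * s (c b) < f b + \<epsilon> * s b) (at_right 0)" if "b \<in> I" for b
  proof (rule order_tendstoD(1)[where a = 0 and y = "f b - f (c b)" and
        f = "\<lambda>\<epsilon>. (f b + \<epsilon> * s b) - (f (c b) + \<epsilon> * s (c b))", THEN eventually_mono])
    show "((\<lambda>\<epsilon>. (f b + \<epsilon> * s b) - (f (c b) + \<epsilon> * s (c b))) \<longlongrightarrow> f b - f (c b)) (at_right 0)"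
      by (auto intro!: tendsto_eq_intros)
  qed (use c that in auto)
  then have "eventually (\<lambda>\<epsilon>. \<forall>b\<in>I. f (c b) + \<epsilon> * s (c b) < f b + \<epsilon> * s b) (at_right 0)"
    using fin by (intro eventually_ball_finite) auto
  then have "eventually (\<lambda>\<epsilon>. 0 < \<epsilon> \<and> (\<forall>b\<in>I. f (c b) + \<epsilon> * s (c b) < f b + \<epsilon> * s b)) (at_right 0)"
    using eventually_at_right_less by (rule eventually_conj[rotated])
  then obtain \<epsilon> where \<epsilon>: "0 < \<epsilon>" "\<And>b. b \<in> I \<Longrightarrow> f (c b) + \<epsilon> * s (c b) < f b + \<epsilon> * s b"
    using eventually_happens'[OF trivial_limit_at_right_real] by blast
  then show False
    using min[OF \<epsilon>(1)] c(1) by (meson not_le)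
qed

lemma supp_weight_add_const:
  "supp_weight (\<lambda>i. w i + \<epsilon>) x = supp_weight w x + \<epsilon> * supp_weight (\<lambda>_. 1) x"
  by (simp add: supp_weight_def sum.distrib)

lemma total_weight_add_const:
  "total_weight (\<lambda>i. w i + \<epsilon>) B = total_weight w B + \<epsilon> * total_weight (\<lambda>_. 1) B"
  by (simp add: total_weight_def supp_weight_add_const sum.distrib sum_distrib_left)

text \<open>The second assumption expresses that \<open>e\<close> is not a loop: the vectors
  supported on \<open>e\<close> alone are the kernel of forgetting coordinate
  \<open>e\<close>.\<close>

lemma inj_on_contraction:
  assumes "arc_space.subspace V" "\<forall>x\<in>V. supp x \<subseteq> {e} \<longrightarrow> x = 0"
  shows "inj_on (\<lambda>x. x(e := 0)) V"
proof (rule inj_onI)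
  fix x y assume xy: "x \<in> V" "y \<in> V" "x(e := 0) = y(e := 0)"
  have "supp (x - y) \<subseteq> {e}"
    using xy(3) by (auto simp: fun_eq_iff split: if_splits)
  moreover have "x - y \<in> V" using xy assms(1) by (intro arc_space.subspace_diff)
  ultimately show "x = y" using assms(2) by auto
qed

text \<open>A priori \<open>x e\<close> could be any real number. A conformal circuit
  \<open>d\<close> below \<open>x\<close> has, off \<open>e\<close>, the same support by minimality,
  and then the same entries because these are signs; injectivity gives \<open>d = x\<close>.\<close>

lemma signed_circuit_contraction_lift:
  assumes V: "regular_space V" and e: "\<forall>x\<in>V. supp x \<subseteq> {e} \<longrightarrow> x = 0"
    and x: "x \<in> V" "x(e := 0) \<in> signed_circuits ((\<lambda>x. x(e := 0)) ` V)"
  shows "x \<in> signed_circuits V"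
proof -
  note inj = inj_on_contraction[OF regular_space_subspace[OF V] e]
  have "x \<noteq> 0"
  proof
    assume "x = 0"
    then have "x(e := 0) = 0" by (simp add: fun_eq_iff)
    then show False using x(2) by (simp add: signed_circuits_def)
  qed
  then obtain d where d: "d \<in> signed_circuits V" "\<And>i. d i \<noteq> 0 \<Longrightarrow> 0 < d i * x i"
    using V x(1) by (auto simp: regular_space_def)
  have dV: "d \<in> V" "d \<noteq> 0" using d(1) by (auto simp: signed_circuits_def)
  have "d(e := 0) \<noteq> 0"
  proof
    assume "d(e := 0) = 0"
    then have "supp d \<subseteq> {e}" by (auto simp: fun_eq_iff split: if_splits)
    then show False using e dV by blast
  qed
  moreover have "supp (d(e := 0)) \<subseteq> supp (x(e := 0))"
    using d(2) by fastforce
  ultimately have supp: "supp (d(e := 0)) = supp (x(e := 0))"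
    using x(2) dV(1) by (auto simp: signed_circuits_def)
  have "d i = x i" if "i \<noteq> e" for i
  proof -
    have vals: "d i \<in> {- 1, 0, 1}" "(x(e := 0)) i \<in> {- 1, 0, 1}"
      using d(1) x(2) by (auto simp: signed_circuits_def)
    have "d i = 0 \<longleftrightarrow> x i = 0"
      using supp that by (auto simp: set_eq_iff split: if_splits)
    then show ?thesis using vals d(2)[of i] that by auto
  qed
  then have "d(e := 0) = x(e := 0)" by (auto simp: fun_eq_iff)
  then have "d = x" using inj dV(1) x(1) by (auto dest: inj_onD)
  then show ?thesis using d(1) by simp
qed

text \<open>The lift is the preimage of \<open>B\<close> in \<open>V\<close>. It turns each
  competitor in the contraction into a competitor in \<open>V\<close>.\<close>

lemma circuit_basis_contraction_lift:
  assumes V: "regular_space V" and e: "\<forall>x\<in>V. supp x \<subseteq> {e} \<longrightarrow> x = 0"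
    and B: "circuit_basis ((\<lambda>x. x(e := 0)) ` V) B"
  obtains L where "circuit_basis V L" "(\<lambda>x. x(e := 0)) ` L = B"
proof
  define \<pi> where "\<pi> = (\<lambda>x :: 'a \<Rightarrow> real. x(e := 0))"
  interpret \<pi>: Vector_Spaces.linear scale_fun scale_fun \<pi>
    unfolding \<pi>_def by (rule linear_upd_zero)
  note Bd = circuit_basisD[OF B, folded \<pi>_def]
  define L where "L = {x \<in> V. \<pi> x \<in> B}"
  have inj: "inj_on \<pi> V"
    unfolding \<pi>_def using regular_space_subspace[OF V] e by (rule inj_on_contraction)
  have LV: "L \<subseteq> V" by (auto simp: L_def)
  have img: "\<pi> ` L = B"
    using Bd(2) by (auto simp: L_def)
  then show "(\<lambda>x. x(e := 0)) ` L = B"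
    by (simp add: \<pi>_def)
  have spanL: "arc_space.span L \<subseteq> V"
    using LV regular_space_subspace[OF V] by (rule arc_space.span_minimal)
  have "\<pi> ` arc_space.span L = \<pi> ` V"
    using img Bd(4) by (simp add: \<pi>.span_image[symmetric])
  then have "arc_space.span L = V"
    using inj_on_image_eq_iff[OF inj spanL] by simp
  moreover have "L \<subseteq> signed_circuits V"
  proof
    fix x assume "x \<in> L"
    then have "x \<in> V" "x(e := 0) \<in> signed_circuits ((\<lambda>x. x(e := 0)) ` V)"
      using Bd(1) by (auto simp: L_def \<pi>_def)
    then show "x \<in> signed_circuits V"
      using signed_circuit_contraction_lift[OF V e] by blast
  qed
  moreover have "arc_space.independent L"
  proof
    assume "arc_space.dependent L"
    then obtain a where a: "a \<in> L" "a \<in> arc_space.span (L - {a})"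
      by (auto simp: arc_space.dependent_def)
    have "\<pi> ` (L - {a}) = B - {\<pi> a}"
      using img inj_on_image_set_diff[OF inj_on_subset[OF inj LV], of L "{a}"] a(1)
      by simp
    then have "\<pi> a \<in> arc_space.span (B - {\<pi> a})"
      using a(2) \<pi>.span_image[of "L - {a}"] by auto
    moreover have "\<pi> a \<in> B" using a(1) by (simp add: L_def)
    ultimately show False
      using Bd(3) by (auto simp: arc_space.dependent_def)
  qed
  ultimately show "circuit_basis V L"
    by (simp add: circuit_basis_def)
qed

lemma supp_weight_contraction:
  assumes "finite (supp x)"
  shows "supp_weight (w(e := 0)) x = supp_weight w (x(e := 0))"
  unfolding supp_weight_def
  by (rule sum.mono_neutral_cong_right) (use assms in \<open>auto split: if_splits\<close>)

text \<open>Forgetting \<open>e\<close> neither merges members of \<open>S\<close> nor changes their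
  weight when \<open>e\<close> itself weighs 0.\<close>

lemma total_weight_contraction:
  assumes V: "regular_space V" and e: "\<forall>x\<in>V. supp x \<subseteq> {e} \<longrightarrow> x = 0" and "S \<subseteq> V"
  shows "total_weight (w(e := 0)) S = total_weight w ((\<lambda>x. x(e := 0)) ` S)"
proof -
  have "inj_on (\<lambda>x. x(e := 0)) S"
    using inj_on_contraction[OF regular_space_subspace[OF V] e] \<open>S \<subseteq> V\<close> by (auto intro: inj_on_subset)
  then show ?thesis
    using regular_space_finite_supp[OF V] \<open>S \<subseteq> V\<close>
    by (auto simp: total_weight_def sum.reindex supp_weight_contraction intro!: sum.cong)
qed

text \<open>Otherwise \<open>C\<close> decomposes into two vectors whose supports off
  \<open>e\<close> are proper subsets of that of \<open>C\<close>. One of them leaves the span of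
  \<open>B - {C}\<close> and contains a circuit that can be exchanged for \<open>C\<close>; positive
  weights off \<open>e\<close> make this a strict improvement.\<close>

lemma minimum_basis_contraction_circuit:
  assumes V: "regular_space V" and e: "\<forall>x\<in>V. supp x \<subseteq> {e} \<longrightarrow> x = 0"
    and w: "\<And>i. 0 < w i"
    and B: "circuit_basis V B"
    and min: "\<And>B'. circuit_basis V B' \<Longrightarrow> total_weight (w(e := 0)) B \<le> total_weight (w(e := 0)) B'"
    and C: "C \<in> B"
  shows "C(e := 0) \<in> signed_circuits ((\<lambda>x. x(e := 0)) ` V)"
proof (rule ccontr)
  assume not: "C(e := 0) \<notin> signed_circuits ((\<lambda>x. x(e := 0)) ` V)"
  note Bd = circuit_basisD[OF B]
  have sub: "arc_space.subspace V" using V by (rule regular_space_subspace)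
  have CV: "C \<in> signed_circuits V" "C \<in> V" "C \<noteq> 0"
    using C Bd(1) by (auto simp: signed_circuits_def)
  have "C(e := 0) \<noteq> 0"
  proof
    assume "C(e := 0) = 0"
    then have "supp C \<subseteq> {e}" by (auto simp: fun_eq_iff split: if_splits)
    then show False using e CV by blast
  qed
  moreover have "range (C(e := 0)) \<subseteq> {- 1, 0, 1}"
    using CV(1) by (auto simp: signed_circuits_def)
  \<comment> \<open>Of the three clauses defining a circuit only minimality can fail.\<close>
  ultimately obtain y where y: "y \<in> (\<lambda>x. x(e := 0)) ` V" "y \<noteq> 0"
      "supp y \<subset> supp (C(e := 0))"
    using not CV(2) by (auto simp: signed_circuits_def)
  obtain Y where Y: "Y \<in> V" "y = Y(e := 0)" using y(1) by blast
  obtain f where "y f \<noteq> 0" using y(2) by (auto simp: fun_eq_iff)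
  then have f: "Y f \<noteq> 0" "f \<noteq> e" "C f \<noteq> 0" using Y(2) y(3) by (auto split: if_splits)
  \<comment> \<open>The second part of \<open>C\<close>: the multiple of \<open>Y\<close> cancels
    coordinate \<open>f\<close>, so \<open>Z\<close> too has smaller support off
    \<open>e\<close>.\<close>
  define Z where "Z = C - scale_fun (C f / Y f) Y"
  have Z: "Z \<in> V" unfolding Z_def using sub CV Y
    by (intro arc_space.subspace_diff arc_space.subspace_scale)
  have YC: "C i \<noteq> 0" if "i \<noteq> e" "Y i \<noteq> 0" for i
    using y(3) that Y(2) by (auto simp: psubset_eq subset_iff split: if_splits)
  have "supp (Z(e := 0)) \<subseteq> supp (C(e := 0)) - {f}"
    using f YC by (auto simp: Z_def split: if_splits)
  then have Z': "supp (Z(e := 0)) \<subset> supp (C(e := 0))"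
    using f by auto
  let ?W = "arc_space.span (B - {C})"
  have "C \<notin> ?W" using Bd(3) C by (auto simp: arc_space.dependent_def)
  moreover have "C = Z + scale_fun (C f / Y f) Y" by (simp add: Z_def)
  ultimately have "Y \<notin> ?W \<or> Z \<notin> ?W"
    by (metis arc_space.span_add arc_space.span_scale)
  then obtain X where X: "X \<in> V" "X \<notin> ?W" "supp (X(e := 0)) \<subset> supp (C(e := 0))"
    using Y y(3) Z Z' by blast
  obtain c where c: "c \<in> signed_circuits V" "supp c \<subseteq> supp X" "c \<notin> ?W"
    using regular_space_circuit_notin_subspace[OF V X(1) _ X(2)] by auto
  have cV: "c \<in> V" using c(1) by (simp add: signed_circuits_def)
  have "supp (c(e := 0)) \<subseteq> supp (X(e := 0))"
    using c(2) by (auto split: if_splits)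
  then have c': "supp (c(e := 0)) \<subset> supp (C(e := 0))"
    using X(3) by blast
  then obtain g where g: "g \<in> supp (C(e := 0)) - supp (c(e := 0))" by blast
  have finC: "finite (supp C)" using regular_space_finite_supp[OF V CV(2)] .
  then have "finite (supp (C(e := 0)))"
    by (rule rev_finite_subset) (auto split: if_splits)
  then have "supp_weight w (c(e := 0)) < supp_weight w (C(e := 0))"
    unfolding supp_weight_def using c' g w less_imp_le[OF w]
    by (intro sum_strict_mono2[of _ _ g]) auto
  then have less: "supp_weight (w(e := 0)) c < supp_weight (w(e := 0)) C"
    using supp_weight_contraction regular_space_finite_supp[OF V] cV CV(2) by metis
  \<comment> \<open>Ensures that inserting \<open>c\<close> adds exactly its own weight to that of
    \<open>B - {C}\<close>.\<close>
  have "c \<notin> B - {C}"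
    using c(3) by (rule contrapos_nn) (rule arc_space.span_base)
  then have "total_weight (w(e := 0)) (insert c (B - {C})) < total_weight (w(e := 0)) B"
    using less circuit_basis_finite[OF V B] by (simp add: total_weight_def sum.remove[OF _ C])
  then show False
    using min[OF circuit_basis_exchange[OF V B C c(1,3)]] by simp
qed

text \<open>A circuit of the contraction lifts to a circuit of \<open>V\<close>; its integer
  expansion in \<open>B\<close> is carried back by linearity with the same coefficients.\<close>

lemma integral_circuit_basis_contraction:
  assumes V: "regular_space V" and e: "\<forall>x\<in>V. supp x \<subseteq> {e} \<longrightarrow> x = 0"
    and B: "integral_circuit_basis V B"
    and circ: "\<And>C. C \<in> B \<Longrightarrow> C(e := 0) \<in> signed_circuits ((\<lambda>x. x(e := 0)) ` V)"
  shows "integral_circuit_basis ((\<lambda>x. x(e := 0)) ` V) ((\<lambda>x. x(e := 0)) ` B)"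
proof -
  define \<pi> where "\<pi> = (\<lambda>x :: 'a \<Rightarrow> real. x(e := 0))"
  interpret \<pi>: Vector_Spaces.linear scale_fun scale_fun \<pi>
    unfolding \<pi>_def by (rule linear_upd_zero)
  have BV: "circuit_basis V B" using B by (simp add: integral_circuit_basis_def)
  note Bd = circuit_basisD[OF BV]
  have inj: "inj_on \<pi> V"
    unfolding \<pi>_def using regular_space_subspace[OF V] e by (rule inj_on_contraction)
  then have injB: "inj_on \<pi> B" using Bd(2) by (rule inj_on_subset)
  have "arc_space.independent (\<pi> ` B)"
    using Bd(3,4) inj by (intro \<pi>.independent_injective_image) auto
  moreover have "arc_space.span (\<pi> ` B) = \<pi> ` V"
    using Bd(4) by (simp add: \<pi>.span_image)
  moreover have "\<pi> ` B \<subseteq> signed_circuits (\<pi> ` V)"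
    using circ by (auto simp: \<pi>_def)
  moreover have "\<exists>k :: ('a \<Rightarrow> real) \<Rightarrow> int. x = (\<Sum>b\<in>\<pi> ` B. scale_fun (of_int (k b)) b)"
    if x: "x \<in> signed_circuits (\<pi> ` V)" for x
  proof -
    obtain y where y: "y \<in> V" "x = \<pi> y"
      using x by (auto simp: signed_circuits_def)
    then have "y \<in> signed_circuits V"
      using signed_circuit_contraction_lift[OF V e, of y] x by (simp add: \<pi>_def)
    then obtain k :: "('a \<Rightarrow> real) \<Rightarrow> int" where k: "y = (\<Sum>b\<in>B. scale_fun (of_int (k b)) b)"
      using B by (auto simp: integral_circuit_basis_def)
    have "x = (\<Sum>b\<in>B. scale_fun (of_int (k b)) (\<pi> b))"
      unfolding y(2) by (subst k) (simp add: \<pi>.sum \<pi>.scale)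
    also have "\<dots> = (\<Sum>b\<in>\<pi> ` B. scale_fun (of_int (k (inv_into B \<pi> b))) b)"
      using injB by (simp add: sum.reindex)
    finally show ?thesis by (rule exI[of _ "\<lambda>b. k (inv_into B \<pi> b)"])
  qed
  ultimately show ?thesis
    unfolding integral_circuit_basis_def circuit_basis_def \<pi>_def by blast
qed

text \<open>
  With weight 0 on \<open>e\<close> and positive weights elsewhere, no circuit of a minimum basis has \<open>e\<close> as a
  chord, so a minimum basis contracts to a basis of circuits. Arbitrary nonnegative weights are
  limits of positive ones, and there are only finitely many bases.
\<close>

lemma integrally_optimal_contraction:
  assumes V: "regular_space V" and opt: "integrally_optimal V"
    and e: "\<forall>x\<in>V. supp x \<subseteq> {e} \<longrightarrow> x = 0"
  shows "integrally_optimal ((\<lambda>x. x(e := 0)) ` V)"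
  unfolding integrally_optimal_def
proof (intro allI impI)
  define V' where "V' = (\<lambda>x. x(e := 0)) ` V"
  fix w :: "'a \<Rightarrow> real" assume w: "\<forall>i. 0 \<le> w i"
  obtain E where E: "finite E" "\<And>x. x \<in> V \<Longrightarrow> supp x \<subseteq> E"
    using V by (auto simp: regular_space_def)
  have "finite (signed_circuits V')"
    by (rule finite_signed_circuits[OF E(1)]) (use E(2) in \<open>fastforce simp: V'_def split: if_splits\<close>)
  then have fin: "finite {B. integral_circuit_basis V' B}"
    by (rule finite_subset[rotated, OF finite_Pow_iff[THEN iffD2]])
      (auto simp: integral_circuit_basis_def circuit_basis_def)
  \<comment> \<open>The weight \<open>w + \<epsilon>\<close> changes the total weight linearly in
    \<open>\<epsilon>\<close>; the slope is the sum of the support sizes.\<close>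
  have "\<exists>B\<in>{B. integral_circuit_basis V' B}. \<forall>B'\<in>{B. circuit_basis V' B}.
      total_weight w B + \<epsilon> * total_weight (\<lambda>_. 1) B \<le> total_weight w B' + \<epsilon> * total_weight (\<lambda>_. 1) B'"
    if \<epsilon>: "0 < \<epsilon>" for \<epsilon>
  proof -
    define w' where "w' = (\<lambda>i. w i + \<epsilon>)"
    have w': "0 < w' i" for i using w \<epsilon> by (simp add: w'_def add_nonneg_pos)
    then have "\<forall>i. 0 \<le> (w'(e := 0)) i" by (simp add: less_imp_le)
    then obtain B where B: "integral_circuit_basis V B"
      and Bmin: "\<And>B'. circuit_basis V B' \<Longrightarrow> total_weight (w'(e := 0)) B \<le> total_weight (w'(e := 0)) B'"
      using opt unfolding integrally_optimal_def by blast
    have BV: "circuit_basis V B" using B by (simp add: integral_circuit_basis_def)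
    have "integral_circuit_basis V' ((\<lambda>x. x(e := 0)) ` B)"
      unfolding V'_def
      using minimum_basis_contraction_circuit[OF V e w' BV Bmin]
      by (intro integral_circuit_basis_contraction[OF V e B]) auto
    moreover have "total_weight w' ((\<lambda>x. x(e := 0)) ` B) \<le> total_weight w' B'"
      if B': "circuit_basis V' B'" for B'
    proof -
      obtain L where L: "circuit_basis V L" "(\<lambda>x. x(e := 0)) ` L = B'"
        using circuit_basis_contraction_lift[OF V e B'[unfolded V'_def]] by blast
      show ?thesis
        using Bmin[OF L(1)] total_weight_contraction[OF V e] circuit_basisD(2)[OF BV]
          circuit_basisD(2)[OF L(1)] L(2) by metis
    qed
    ultimately show ?thesis
      unfolding w'_def total_weight_add_const by blast
  qed
  from minimum_of_perturbed_minima[OF fin this]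
  show "\<exists>B. integral_circuit_basis ((\<lambda>x. x(e := 0)) ` V) B \<and>
      (\<forall>B'. circuit_basis ((\<lambda>x. x(e := 0)) ` V) B' \<longrightarrow> total_weight w B \<le> total_weight w B')"
    unfolding V'_def by blast
qed

section \<open>The cycle space of a digraph\<close>

text \<open>One signed sum over all arcs, in which loops cancel, instead of separate sums over
  out-arcs and in-arcs; single arcs are then easy to split off.\<close>

definition net_outflow :: "('v, 'e) pre_digraph \<Rightarrow> ('e \<Rightarrow> real) \<Rightarrow> 'v \<Rightarrow> real" where
  "net_outflow D x v = (\<Sum>e\<in>arcs D. x e * (of_bool (tail D e = v) - of_bool (head D e = v)))"

text \<open>The flow of \<open>x\<close> measured in the direction of travel, so that a cycle
  carries value 1 on each of its traversals.\<close>

definition traversal_value :: "('e \<Rightarrow> real) \<Rightarrow> 'e \<times> bool \<Rightarrow> real" where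
  "traversal_value x a = (if snd a then x (fst a) else - x (fst a))"

lemma cycle_space_eq_net_outflow:
  assumes "finite (arcs D)"
  shows "cycle_space D = {x. supp x \<subseteq> arcs D \<and> (\<forall>v\<in>verts D. net_outflow D x v = 0)}"
proof -
  have "net_outflow D x v = (\<Sum>e\<in>out_arcs D v. x e) - (\<Sum>e\<in>in_arcs D v. x e)" for x v
    using assms
    by (simp add: net_outflow_def out_arcs_def in_arcs_def sum.inter_filter right_diff_distrib
        sum_subtractf of_bool_def if_distrib[of "\<lambda>t. x _ * t"] cong: if_cong)
  then show ?thesis
    by (auto simp: cycle_space_def supp_def)
qed

lemma net_outflow_add: "net_outflow D (x + y) v = net_outflow D x v + net_outflow D y v"
  by (simp add: net_outflow_def distrib_right sum.distrib)

lemma net_outflow_scale: "net_outflow D (scale_fun c x) v = c * net_outflow D x v"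
  by (simp add: net_outflow_def sum_distrib_left mult.assoc)

lemma subspace_cycle_space:
  assumes "finite (arcs D)"
  shows "arc_space.subspace (cycle_space D)"
  unfolding cycle_space_eq_net_outflow[OF assms]
proof (rule arc_space.subspaceI)
  show "0 \<in> {x. supp x \<subseteq> arcs D \<and> (\<forall>v\<in>verts D. net_outflow D x v = 0)}"
    by (auto simp: net_outflow_def)
next
  fix x y
  assume "x \<in> {x. supp x \<subseteq> arcs D \<and> (\<forall>v\<in>verts D. net_outflow D x v = 0)}"
    and "y \<in> {x. supp x \<subseteq> arcs D \<and> (\<forall>v\<in>verts D. net_outflow D x v = 0)}"
  then show "x + y \<in> {x. supp x \<subseteq> arcs D \<and> (\<forall>v\<in>verts D. net_outflow D x v = 0)}"
    by (force simp: net_outflow_add)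
next
  fix c x
  assume "x \<in> {x. supp x \<subseteq> arcs D \<and> (\<forall>v\<in>verts D. net_outflow D x v = 0)}"
  then show "scale_fun c x \<in> {x. supp x \<subseteq> arcs D \<and> (\<forall>v\<in>verts D. net_outflow D x v = 0)}"
    by (auto simp: net_outflow_scale)
qed

section \<open>Cycles as closed walks, and their incidence vectors\<close>

lemma traversals_simps [simp]:
  "verts (traversals D) = verts D"
  "arcs (traversals D) = arcs D \<times> UNIV"
  "tail (traversals D) (e, b) = (if b then tail D e else head D e)"
  "head (traversals D) (e, b) = (if b then head D e else tail D e)"
  by (simp_all add: traversals_def)

lemma wf_digraph_traversals:
  assumes "wf_digraph D"
  shows "wf_digraph (traversals D)"
  using assms by (auto simp: wf_digraph_def)

text \<open>The sum telescopes along the walk; it vanishes for closed walks, which gives flow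
  conservation for cycles.\<close>

lemma sum_list_cas:
  assumes "pre_digraph.cas T u p v"
  shows "(\<Sum>a\<leftarrow>p. of_bool (tail T a = z) - of_bool (head T a = z)) =
    of_bool (u = z) - (of_bool (v = z) :: real)"
  using assms by (induction p arbitrary: u) (auto simp: pre_digraph.cas.simps)

lemma awalk_verts_cas:
  assumes "pre_digraph.cas T u p v"
  shows "pre_digraph.awalk_verts T u p = u # map (head T) p"
  using assms
  by (induction p arbitrary: u) (auto simp: pre_digraph.cas.simps pre_digraph.awalk_verts.simps)

lemma tail_nth_cas:
  assumes "pre_digraph.cas T u p v" "i < length p"
  shows "tail T (p ! i) = (if i = 0 then u else head T (p ! (i - 1)))"
  using assms
proof (induction p arbitrary: u i)
  case (Cons a p)
  then show ?case
    by (cases i) (auto simp: pre_digraph.cas.simps)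
qed simp

lemma head_last_cas:
  assumes "pre_digraph.cas T u p v" "p \<noteq> []"
  shows "head T (p ! (length p - 1)) = v"
  using assms
proof (induction p arbitrary: u)
  case (Cons a p)
  then show ?case
    by (cases p) (auto simp: pre_digraph.cas.simps)
qed simp

lemma is_cycleE:
  assumes "is_cycle D p"
  obtains u where "p \<noteq> []" "set p \<subseteq> arcs D \<times> UNIV" "distinct (map fst p)"
    "pre_digraph.cas (traversals D) u p u" "distinct (map (head (traversals D)) p)"
proof -
  obtain u where "pre_digraph.awalk (traversals D) u p u"
      "distinct (tl (pre_digraph.awalk_verts (traversals D) u p))" "p \<noteq> []" "distinct (map fst p)"
    using assms by (auto simp: is_cycle_def pre_digraph.cycle_def)
  then show thesis
    using that by (auto simp: pre_digraph.awalk_def awalk_verts_cas)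
qed

lemma supp_incidence_vector: "supp (incidence_vector p) = fst ` set p"
proof -
  have "incidence_vector p e \<noteq> 0 \<longleftrightarrow> (\<exists>b. (e, b) \<in> set p)" for e
    unfolding incidence_vector_def using bool.exhaust by (metis (full_types) neg_equal_0_iff_equal zero_neq_one)
  then show ?thesis by (force simp: supp_def)
qed

text \<open>Distinct underlying arcs exclude that both directions of one arc occur, where
  \<open>incidence_vector\<close> would give preference to the forward one.\<close>

lemma traversal_value_incidence_vector:
  assumes "distinct (map fst p)" "a \<in> set p"
  shows "traversal_value (incidence_vector p) a = 1"
proof -
  have "inj_on fst (set p)" using assms(1) by (simp add: distinct_map)
  then have "b = c" if "(e, b) \<in> set p" "(e, c) \<in> set p" for e b c
    using that inj_onD[of fst "set p" "(e, b)" "(e, c)"] by auto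
  moreover obtain e b where "a = (e, b)" by (cases a)
  ultimately show ?thesis
    using assms(2) by (cases b) (auto simp: traversal_value_def incidence_vector_def)
qed

text \<open>Traversing an arc backward swaps its ends and negates its value, so each summand is
  unchanged.\<close>

lemma net_outflow_traversals:
  assumes "finite (arcs D)" "distinct (map fst p)" "set p \<subseteq> arcs D \<times> UNIV" "supp y \<subseteq> fst ` set p"
  shows "net_outflow D y v = (\<Sum>a\<in>set p. traversal_value y a *
    (of_bool (tail (traversals D) a = v) - of_bool (head (traversals D) a = v)))"
proof -
  have inj: "inj_on fst (set p)" using assms(2) by (simp add: distinct_map)
  have "net_outflow D y v = (\<Sum>e\<in>fst ` set p. y e * (of_bool (tail D e = v) - of_bool (head D e = v)))"
    unfolding net_outflow_def using assms by (intro sum.mono_neutral_right) auto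
  also have "\<dots> = (\<Sum>a\<in>set p. y (fst a) * (of_bool (tail D (fst a) = v) - of_bool (head D (fst a) = v)))"
    by (simp add: sum.reindex[OF inj])
  also have "\<dots> = (\<Sum>a\<in>set p. traversal_value y a *
      (of_bool (tail (traversals D) a = v) - of_bool (head (traversals D) a = v)))"
  proof (rule sum.cong)
    fix a assume "a \<in> set p"
    obtain e b where "a = (e, b)" by (cases a)
    then show "y (fst a) * (of_bool (tail D (fst a) = v) - of_bool (head D (fst a) = v)) =
        traversal_value y a * (of_bool (tail (traversals D) a = v) - of_bool (head (traversals D) a = v))"
      by (cases b) (simp_all add: traversal_value_def algebra_simps)
  qed simp
  finally show ?thesis .
qed

lemma incidence_vector_in_cycle_space:
  assumes fin: "finite (arcs D)" and p: "is_cycle D p"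
  shows "incidence_vector p \<in> cycle_space D"
proof -
  obtain u where u: "p \<noteq> []" "set p \<subseteq> arcs D \<times> UNIV" "distinct (map fst p)"
      "pre_digraph.cas (traversals D) u p u" "distinct (map (head (traversals D)) p)"
    using p by (rule is_cycleE)
  have dp: "distinct p" using u(3) by (simp add: distinct_map)
  have "net_outflow D (incidence_vector p) v = 0" for v
  proof -
    have "net_outflow D (incidence_vector p) v =
        (\<Sum>a\<in>set p. of_bool (tail (traversals D) a = v) - of_bool (head (traversals D) a = v))"
      using u fin by (simp add: net_outflow_traversals[of D p] supp_incidence_vector
          traversal_value_incidence_vector)
    also have "\<dots> = (\<Sum>a\<leftarrow>p. of_bool (tail (traversals D) a = v) - of_bool (head (traversals D) a = v))"
      using dp by (simp add: sum_list_distinct_conv_sum_set)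
    also have "\<dots> = 0"
      using sum_list_cas[OF u(4), of v] by simp
    finally show ?thesis .
  qed
  moreover have "supp (incidence_vector p) \<subseteq> arcs D"
    using u(2) by (auto simp: supp_incidence_vector)
  ultimately show ?thesis
    by (simp add: cycle_space_eq_net_outflow[OF fin])
qed

text \<open>Flow conservation at the vertex between two consecutive arcs of a cycle forces equal values.\<close>

lemma supp_in_cycle_space_minimal:
  assumes D: "fin_digraph D" and p: "is_cycle D p"
    and y: "y \<in> cycle_space D" "supp y \<subseteq> fst ` set p" "y \<noteq> 0"
  shows "supp y = fst ` set p"
proof -
  interpret fin_digraph D by (rule D)
  let ?T = "traversals D"
  obtain u where u: "p \<noteq> []" "set p \<subseteq> arcs D \<times> UNIV" "distinct (map fst p)"
      "pre_digraph.cas ?T u p u" "distinct (map (head ?T) p)"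
    using p by (rule is_cycleE)
  have dp: "distinct p" using u(3) by (simp add: distinct_map)
  define n where "n = length p"
  have hd_eq: "head ?T (p ! j) = head ?T (p ! i) \<longleftrightarrow> j = i" if "i < n" "j < n" for i j
    using u(5) that by (auto simp: distinct_conv_nth n_def)
  have step: "traversal_value y (p ! Suc i) = traversal_value y (p ! i)" if i: "Suc i < n" for i
  proof -
    define z where "z = head ?T (p ! i)"
    have head_z: "head ?T (p ! j) = z \<longleftrightarrow> j = i" if "j < n" for j
      unfolding z_def using i that by (intro hd_eq) auto
    have tail_z: "tail ?T (p ! j) = z \<longleftrightarrow> j = Suc i" if "j < n" for j
    proof (cases j)
      \<comment> \<open>The walk is closed: the first tail is the last head, which differs from
        \<open>z\<close> because \<open>Suc i < n\<close> excludes \<open>i = n - 1\<close>.\<close>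
      case 0
      then have "tail ?T (p ! j) = head ?T (p ! (n - 1))"
        using tail_nth_cas[OF u(4), of 0] head_last_cas[OF u(4,1)] u(1) by (simp add: n_def)
      then show ?thesis using head_z[of "n - 1"] i 0 by auto
    next
      case (Suc k)
      then have "tail ?T (p ! j) = head ?T (p ! k)"
        using tail_nth_cas[OF u(4), of j] that by (simp add: n_def)
      then show ?thesis using head_z[of k] that Suc by auto
    qed
    obtain e b where eb: "p ! i = (e, b)" by (cases "p ! i")
    then have "(e, b) \<in> set p" using i nth_mem[of i p] by (simp add: n_def)
    then have "z \<in> verts D"
      unfolding z_def eb using u(2) by auto
    then have "0 = net_outflow D y z"
      using y(1) by (simp add: cycle_space_eq_net_outflow)
    also have "\<dots> = (\<Sum>a\<in>set p. traversal_value y a * (of_bool (tail ?T a = z) - of_bool (head ?T a = z)))"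
      using u y(2) by (intro net_outflow_traversals) auto
    also have "\<dots> = (\<Sum>j<n. traversal_value y (p ! j) *
        (of_bool (tail ?T (p ! j) = z) - of_bool (head ?T (p ! j) = z)))"
      using sum.reindex_bij_betw[OF bij_betw_nth[OF dp, of "{..<n}" "set p"],
          of "\<lambda>a. traversal_value y a * (of_bool (tail ?T a = z) - of_bool (head ?T a = z))"]
      by (simp add: n_def)
    also have "\<dots> = (\<Sum>j<n. (if j = Suc i then traversal_value y (p ! j) else 0) -
        (if j = i then traversal_value y (p ! j) else 0))"
      by (rule sum.cong) (auto simp: head_z tail_z)
    also have "\<dots> = traversal_value y (p ! Suc i) - traversal_value y (p ! i)"
      using i by (simp add: sum_subtractf)
    finally show ?thesis by simp
  qed
  have const: "traversal_value y (p ! i) = traversal_value y (p ! 0)" if "i < n" for i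
    using that by (induction i) (auto simp: step)
  have zero_iff: "traversal_value y a = 0 \<longleftrightarrow> y (fst a) = 0" for a
    by (simp add: traversal_value_def)
  obtain f where f: "y f \<noteq> 0" using y(3) by (auto simp: fun_eq_iff)
  then obtain a where "a \<in> set p" "fst a = f" using y(2) by force
  then obtain i where i: "i < n" "p ! i = a" by (auto simp: in_set_conv_nth n_def)
  then have "traversal_value y (p ! 0) \<noteq> 0"
    using const[OF i(1)] zero_iff[of a] f \<open>fst a = f\<close> by auto
  then have "y (fst a) \<noteq> 0" if "a \<in> set p" for a
    using that const zero_iff by (metis in_set_conv_nth n_def)
  then have "fst ` set p \<subseteq> supp y" by auto
  then show ?thesis using y(2) by blast
qed

lemma is_cycle_signed_circuit:
  assumes D: "fin_digraph D" and p: "is_cycle D p"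
  shows "incidence_vector p \<in> signed_circuits (cycle_space D)"
proof -
  interpret fin_digraph D by (rule D)
  have "p \<noteq> []" using p by (rule is_cycleE)
  then have "supp (incidence_vector p) \<noteq> {}" by (simp add: supp_incidence_vector)
  then have "incidence_vector p \<noteq> 0" by simp
  moreover have "range (incidence_vector p) \<subseteq> {- 1, 0, 1}"
    by (auto simp: incidence_vector_def)
  ultimately show ?thesis
    using incidence_vector_in_cycle_space[OF finite_arcs p] supp_in_cycle_space_minimal[OF D p]
    by (simp add: signed_circuits_def supp_incidence_vector)
qed

text \<open>Following arcs in the direction of the flow \<open>x\<close> never gets stuck, so it closes up to a cycle.\<close>

lemma ex_conformal_cycle:
  assumes D: "fin_digraph D" and x: "x \<in> cycle_space D" "x \<noteq> 0"
  obtains p where "is_cycle D p" "\<And>a. a \<in> set p \<Longrightarrow> 0 < traversal_value x a"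
proof -
  interpret D: fin_digraph D by (rule D)
  \<comment> \<open>Only traversals along positive flow are kept, hence at most one direction of
    each arc.\<close>
  define T where "T = traversals D\<lparr>arcs := {a \<in> arcs D \<times> UNIV. 0 < traversal_value x a}\<rparr>"
  have T: "verts T = verts D" "arcs T = {a \<in> arcs D \<times> UNIV. 0 < traversal_value x a}"
      "tail T = tail (traversals D)" "head T = head (traversals D)"
    by (simp_all add: T_def)
  have wfT: "wf_digraph T"
    by (auto simp: wf_digraph_def T)
  interpret T: wf_digraph T by (rule wfT)
  have net: "net_outflow D x v = 0" if "v \<in> verts D" for v
    using x(1) that by (simp add: cycle_space_eq_net_outflow[OF D.finite_arcs])
  have succ: "\<exists>b\<in>arcs T. tail T b = head T a" if a: "a \<in> arcs T" for a
  proof (rule ccontr)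
    define z where "z = head T a"
    assume "\<not> ?thesis"
    then have none: "traversal_value x b \<le> 0" if "b \<in> arcs D \<times> UNIV" "tail T b = z" for b
      using that by (auto simp: T(2) z_def not_less)
    have x_le: "x e \<le> 0" if "e \<in> arcs D" "tail D e = z" for e
      using none[of "(e, True)"] that by (simp add: T traversal_value_def)
    have x_ge: "0 \<le> x e" if "e \<in> arcs D" "head D e = z" for e
      using none[of "(e, False)"] that by (simp add: T traversal_value_def)
    let ?t = "\<lambda>e. x e * (of_bool (tail D e = z) - of_bool (head D e = z))"
    \<comment> \<open>With no traversal in \<open>T\<close> leaving \<open>z\<close>, no term of the
      net outflow at \<open>z\<close> is positive. The terms sum to 0, so all vanish; but
      \<open>a\<close> brings positive flow into \<open>z\<close>, or leaves \<open>z\<close> itself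
      if it is a loop.\<close>
    have nonpos: "?t e \<le> 0" if "e \<in> arcs D" for e
      using x_le[OF that] x_ge[OF that] by (auto simp: of_bool_def)
    have "z \<in> verts D" using a T.head_in_verts[of a] by (simp add: z_def T(1))
    then have "(\<Sum>e\<in>arcs D. ?t e) = 0" using net by (simp add: net_outflow_def)
    then have zero: "?t e = 0" if "e \<in> arcs D" for e
      using sum_nonneg_eq_0_iff[of "arcs D" "\<lambda>e. - ?t e"] nonpos D.finite_arcs that
      unfolding sum_negf by auto
    obtain e b where eb: "a = (e, b)" by (cases a)
    have "e \<in> arcs D" "0 < traversal_value x (e, b)" using a eb by (auto simp: T(2))
    then show False
      using zero[of e] x_le[of e] x_ge[of e] eb
      by (cases b) (auto simp: z_def T traversal_value_def)
  qed
  have "\<exists>v. (v, v) \<in> (arcs_ends T)\<^sup>+"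
  proof (rule ccontr)
    assume "\<not> ?thesis"
    then have acyc: "acyclic (arcs_ends T)" by (simp add: acyclic_def)
    have "finite (arcs T)"
      using D.finite_arcs by (auto simp: T(2))
    then have "finite (arcs_ends T)" by (simp add: arcs_ends_def)
    then have wf: "wf ((arcs_ends T)\<inverse>)" using acyc by (rule finite_acyclic_wf_converse)
    obtain f where f: "x f \<noteq> 0" using x(2) by (auto simp: fun_eq_iff)
    then have "f \<in> arcs D" using x(1) by (auto simp: cycle_space_def)
    \<comment> \<open>The Boolean \<open>0 < x f\<close> is the direction in which \<open>f\<close>
      carries positive flow.\<close>
    then have "(f, 0 < x f) \<in> arcs T" using f by (auto simp: T(2) traversal_value_def)
    then have "head T (f, 0 < x f) \<in> head T ` arcs T" by blast
    \<comment> \<open>If \<open>T\<close> were acyclic, some head would have no further head among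
      its successors, contradicting \<open>succ\<close>.\<close>
    then obtain z where z: "z \<in> head T ` arcs T"
        "\<And>y. (y, z) \<in> (arcs_ends T)\<inverse> \<Longrightarrow> y \<notin> head T ` arcs T"
      using wfE_min[OF wf] by metis
    then obtain b where "b \<in> arcs T" "tail T b = z" using succ by blast
    then show False using z(2)[of "head T b"] by (auto simp: arcs_ends_conv)
  qed
  then obtain v where "v \<rightarrow>\<^sup>+\<^bsub>T\<^esub> v" by blast
  then obtain q where "T.awalk v q v" "q \<noteq> []" by (auto simp: T.reachable1_awalk)
  then have "T.closed_w q" by (auto simp: T.closed_w_def)
  then obtain p where p: "T.cycle p" using T.closed_w_imp_cycle by blast
  have "subgraph T (traversals D)"
    using wfT wf_digraph_traversals[OF D.wf_digraph_axioms]
    by (auto simp: subgraph_def compatible_def T)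
  then have "pre_digraph.cycle (traversals D) p"
    using wf_digraph.subgraph_cycle[OF wf_digraph_traversals[OF D.wf_digraph_axioms]] p by blast
  moreover have pT: "set p \<subseteq> arcs T"
    using p by (auto simp: T.cycle_def T.awalk_def)
  moreover have "distinct (map fst p)"
  proof -
    have "distinct p" using p by (auto simp: T.cycle_conv)
    moreover have "inj_on fst (arcs T)"
      by (auto simp: inj_on_def T(2) traversal_value_def split: if_splits)
    ultimately show ?thesis using pT by (auto simp: distinct_map intro: inj_on_subset)
  qed
  ultimately show thesis
    using that by (auto simp: is_cycle_def T(2))
qed

lemma ex_conformal_cycle_vector:
  assumes D: "fin_digraph D" and x: "x \<in> cycle_space D" "x \<noteq> 0"
  obtains p where "is_cycle D p"
    "\<And>i. incidence_vector p i \<noteq> 0 \<Longrightarrow> 0 < incidence_vector p i * x i"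
proof -
  obtain p where p: "is_cycle D p" "\<And>a. a \<in> set p \<Longrightarrow> 0 < traversal_value x a"
    using ex_conformal_cycle[OF D x] by blast
  have "0 < incidence_vector p i * x i" if "incidence_vector p i \<noteq> 0" for i
    using that p(2)[of "(i, True)"] p(2)[of "(i, False)"]
    by (auto simp: incidence_vector_def traversal_value_def split: if_splits)
  with p(1) show thesis by (rule that)
qed

text \<open>For the harder inclusion, a cycle conformal to the circuit \<open>x\<close> has the
  support of \<open>x\<close> by minimality; with entries of absolute value 1 and equal signs the
  two vectors coincide.\<close>

lemma cycle_vectors_eq_signed_circuits:
  assumes D: "fin_digraph D"
  shows "cycle_vectors D = signed_circuits (cycle_space D)"
proof
  show "cycle_vectors D \<subseteq> signed_circuits (cycle_space D)"
    using is_cycle_signed_circuit[OF D] by (auto simp: cycle_vectors_def)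
  show "signed_circuits (cycle_space D) \<subseteq> cycle_vectors D"
  proof
    fix x assume x: "x \<in> signed_circuits (cycle_space D)"
    then have "x \<in> cycle_space D" "x \<noteq> 0" by (auto simp: signed_circuits_def)
    then obtain p where p: "is_cycle D p"
        "\<And>i. incidence_vector p i \<noteq> 0 \<Longrightarrow> 0 < incidence_vector p i * x i"
      using ex_conformal_cycle_vector[OF D] by blast
    let ?c = "incidence_vector p"
    have c: "?c \<in> signed_circuits (cycle_space D)"
      using D p(1) by (rule is_cycle_signed_circuit)
    have "supp ?c \<subseteq> supp x" using p(2) by force
    then have supp: "supp ?c = supp x"
      using x c by (simp add: signed_circuits_def)
    have "x i = ?c i" for i
    proof -
      have "x i \<in> {- 1, 0, 1}" "?c i \<in> {- 1, 0, 1}"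
        using x c rangeI[of x i] rangeI[of ?c i] unfolding signed_circuits_def by blast+
      moreover have "?c i = 0 \<longleftrightarrow> x i = 0" using supp by (auto simp: set_eq_iff)
      ultimately show ?thesis using p(2)[of i] by auto
    qed
    then have "x = ?c" by (simp add: fun_eq_iff)
    then show "x \<in> cycle_vectors D" using p(1) by (auto simp: cycle_vectors_def)
  qed
qed

lemma regular_space_cycle_space:
  assumes D: "fin_digraph D"
  shows "regular_space (cycle_space D)"
  unfolding regular_space_def
proof (intro conjI ballI impI)
  interpret fin_digraph D by (rule D)
  show "arc_space.subspace (cycle_space D)" by (rule subspace_cycle_space[OF finite_arcs])
  show "\<exists>E. finite E \<and> (\<forall>x\<in>cycle_space D. supp x \<subseteq> E)"
    by (rule exI[of _ "arcs D"]) (simp add: cycle_space_eq_net_outflow)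
  fix x assume "x \<in> cycle_space D" "x \<noteq> 0"
  then obtain p where "is_cycle D p"
      "\<And>i. incidence_vector p i \<noteq> 0 \<Longrightarrow> 0 < incidence_vector p i * x i"
    using ex_conformal_cycle_vector[OF D] by blast
  then show "\<exists>c\<in>signed_circuits (cycle_space D). \<forall>i. c i \<noteq> 0 \<longrightarrow> 0 < c i * x i"
    using is_cycle_signed_circuit[OF D] by blast
qed

section \<open>Opt-in as a property of cycle spaces\<close>

lemma fin_digraph_orientation:
  assumes "finite_graph G" "orientation_of D G"
  shows "fin_digraph D"
proof
  have ends: "tail D e \<in> vertices G \<and> head D e \<in> vertices G" if "e \<in> edges G" for e
  proof -
    have "set_uprod (Upair (tail D e) (head D e)) \<subseteq> vertices G"
      using assms that by (simp add: finite_graph_def orientation_of_def)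
    then show ?thesis by simp
  qed
  show "e \<in> arcs D \<Longrightarrow> tail D e \<in> verts D" "e \<in> arcs D \<Longrightarrow> head D e \<in> verts D" for e
    using ends assms by (auto simp: orientation_of_def)
  show "finite (verts D)" "finite (arcs D)"
    using assms by (auto simp: finite_graph_def orientation_of_def)
qed

lemma basis_weight_eq_total_weight:
  assumes "B \<subseteq> cycle_space D" "\<And>e. e \<in> arcs D \<Longrightarrow> w e = w' e"
  shows "basis_weight D w B = total_weight w' B"
  unfolding basis_weight_def total_weight_def cycle_weight_def supp_weight_def
proof (intro sum.cong refl)
  fix x assume "x \<in> B"
  then show "{e \<in> arcs D. x e \<noteq> 0} = supp x"
    using assms(1) by (auto simp: cycle_space_def supp_def)
  fix e assume "e \<in> supp x"
  with \<open>x \<in> B\<close> show "w e = w' e"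
    using assms by (auto simp: cycle_space_def)
qed

text \<open>An integral basis no heavier than any directed one is minimum in both classes;
  conversely, if the minima agree, a minimum integral basis is such a basis.\<close>

lemma opt_in_iff:
  assumes "finite_graph G"
  shows "opt_in G \<longleftrightarrow> (\<forall>D. orientation_of D G \<longrightarrow> integrally_optimal (cycle_space D))"
proof -
  have "(\<forall>w :: 'b \<Rightarrow> real. (\<forall>e\<in>edges G. 0 \<le> w e) \<longrightarrow>
        (\<exists>B B'. minimum_directed_cycle_basis D w B \<and> minimum_integral_cycle_basis D w B' \<and>
           basis_weight D w B = basis_weight D w B')) \<longleftrightarrow> integrally_optimal (cycle_space D)"
    (is "?L \<longleftrightarrow> ?R")
    if D: "orientation_of D G" for D
  proof -
    have finD: "fin_digraph D" using assms D by (rule fin_digraph_orientation)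
    have arcs: "arcs D = edges G" using D by (simp add: orientation_of_def)
    have dir: "directed_cycle_basis D B \<longleftrightarrow> circuit_basis (cycle_space D) B" for B
      by (simp add: directed_cycle_basis_def circuit_basis_def cycle_vectors_eq_signed_circuits[OF finD])
    have int: "integral_cycle_basis D B \<longleftrightarrow> integral_circuit_basis (cycle_space D) B" for B
      by (simp add: integral_cycle_basis_def integral_circuit_basis_def dir
          cycle_vectors_eq_signed_circuits[OF finD])
    have int_dir: "integral_cycle_basis D B \<Longrightarrow> directed_cycle_basis D B" for B
      by (simp add: integral_cycle_basis_def)
    show ?thesis
    proof
      assume L: ?L
      show ?R
        unfolding integrally_optimal_def
      proof (intro allI impI)
        fix w :: "'b \<Rightarrow> real" assume "\<forall>i. 0 \<le> w i"
        then obtain B B' where B: "minimum_directed_cycle_basis D w B"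
            "minimum_integral_cycle_basis D w B'" "basis_weight D w B = basis_weight D w B'"
          using L by blast
        have "total_weight w B' \<le> total_weight w B''" if "circuit_basis (cycle_space D) B''" for B''
        proof -
          have "circuit_basis (cycle_space D) B'"
            using B(2) int_dir by (simp add: minimum_integral_cycle_basis_def dir)
          note sub = circuit_basisD(2)[OF this] circuit_basisD(2)[OF that]
          have "basis_weight D w B \<le> basis_weight D w B''"
            using B(1) that by (simp add: minimum_directed_cycle_basis_def dir)
          then show ?thesis
            using B(3) sub by (simp add: basis_weight_eq_total_weight[of _ D w w])
        qed
        then show "\<exists>B. integral_circuit_basis (cycle_space D) B \<and>
            (\<forall>B'. circuit_basis (cycle_space D) B' \<longrightarrow> total_weight w B \<le> total_weight w B')"
          using B(2) int by (auto simp: minimum_integral_cycle_basis_def)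
      qed
    next
      assume R: ?R
      show ?L
      proof (intro allI impI)
        fix w :: "'b \<Rightarrow> real" assume w: "\<forall>e\<in>edges G. 0 \<le> w e"
        \<comment> \<open>Opt-in assumes nonnegative weights on edges only,
          \<open>integrally_optimal\<close> on the whole type; truncation changes \<open>w\<close>
          only outside the edges.\<close>
        define w' where "w' e = max 0 (w e)" for e
        have w': "w e = w' e" if "e \<in> arcs D" for e using that w arcs by (simp add: w'_def)
        have "\<forall>i. 0 \<le> w' i" by (simp add: w'_def)
        then obtain B where B: "integral_circuit_basis (cycle_space D) B"
            "\<forall>B'. circuit_basis (cycle_space D) B' \<longrightarrow> total_weight w' B \<le> total_weight w' B'"
          using R unfolding integrally_optimal_def by blast
        have wt: "basis_weight D w B' = total_weight w' B'" if "directed_cycle_basis D B'" for B'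
          using that circuit_basisD(2)[of "cycle_space D" B'] w'
          by (intro basis_weight_eq_total_weight) (auto simp: dir)
        have intB: "integral_cycle_basis D B" using B(1) by (simp add: int)
        have "basis_weight D w B \<le> basis_weight D w B'" if "directed_cycle_basis D B'" for B'
          using wt[OF that] wt[OF int_dir[OF intB]] B(2) that by (simp add: dir)
        then have "minimum_directed_cycle_basis D w B \<and> minimum_integral_cycle_basis D w B"
          using intB int_dir
          by (simp add: minimum_directed_cycle_basis_def minimum_integral_cycle_basis_def)
        then show "\<exists>B B'. minimum_directed_cycle_basis D w B \<and> minimum_integral_cycle_basis D w B' \<and>
           basis_weight D w B = basis_weight D w B'"
          by blast
      qed
    qed
  qed
  then show ?thesis by (simp add: opt_in_def)
qed

section \<open>Minors\<close>

text \<open>Serves edge and vertex deletion alike. Dropped vertices impose no condition on vectors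
  vanishing on \<open>F\<close>, as no remaining arc touches them.\<close>

lemma cycle_space_deletion:
  assumes fin: "finite (arcs D)"
    and arcs: "arcs D' = arcs D - F" and verts: "verts D' \<subseteq> verts D"
    and ends: "\<And>f. f \<in> arcs D' \<Longrightarrow> tail D' f = tail D f \<and> head D' f = head D f"
    and isolated: "\<And>f. f \<in> arcs D' \<Longrightarrow> tail D f \<in> verts D' \<and> head D f \<in> verts D'"
  shows "cycle_space D' = {x \<in> cycle_space D. \<forall>f\<in>F. x f = 0}"
proof -
  have net: "net_outflow D x v = net_outflow D' x v" if "supp x \<subseteq> arcs D'" for x v
  proof -
    have "net_outflow D x v = (\<Sum>f\<in>arcs D'. x f * (of_bool (tail D f = v) - of_bool (head D f = v)))"
      unfolding net_outflow_def using fin arcs that by (intro sum.mono_neutral_right) auto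
    also have "\<dots> = net_outflow D' x v"
      unfolding net_outflow_def using ends by (intro sum.cong) auto
    finally show ?thesis .
  qed
  have outside: "net_outflow D' x v = 0" if "v \<notin> verts D'" for x v
    unfolding net_outflow_def using that ends isolated by (intro sum.neutral) force
  have "finite (arcs D')" using fin arcs by simp
  note conv = cycle_space_eq_net_outflow[OF fin] cycle_space_eq_net_outflow[OF this]
  show ?thesis
  proof (intro equalityI subsetI)
    fix x assume "x \<in> cycle_space D'"
    then have x: "supp x \<subseteq> arcs D'" "\<And>v. v \<in> verts D' \<Longrightarrow> net_outflow D' x v = 0"
      by (auto simp: conv)
    have "net_outflow D x v = 0" for v
      using net[OF x(1)] x(2) outside by (cases "v \<in> verts D'") auto
    then show "x \<in> {x \<in> cycle_space D. \<forall>f\<in>F. x f = 0}"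
      using x(1) arcs by (auto simp: conv)
  next
    fix x assume "x \<in> {x \<in> cycle_space D. \<forall>f\<in>F. x f = 0}"
    then have x: "supp x \<subseteq> arcs D'" "\<And>v. v \<in> verts D \<Longrightarrow> net_outflow D x v = 0"
      using arcs by (auto simp: conv)
    then show "x \<in> cycle_space D'"
      using net[OF x(1)] verts by (auto simp: conv)
  qed
qed

lemma opt_in_deletion:
  assumes G: "finite_graph G" "opt_in G" and H: "finite_graph H"
    and sub: "vertices H \<subseteq> vertices G" "edges H \<subseteq> edges G"
    and ends: "\<And>f. f \<in> edges H \<Longrightarrow> ends H f = ends G f"
  shows "opt_in H"
  unfolding opt_in_iff[OF H]
proof (intro allI impI)
  fix D' :: "('a, 'b) pre_digraph" assume D': "orientation_of D' H"
  interpret D': fin_digraph D' by (rule fin_digraph_orientation[OF H D'])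
  obtain D0 where D0: "orientation_of D0 G" using ex_orientation by blast
  \<comment> \<open>The given orientation of \<open>H\<close> is extended to \<open>G\<close> by an
    arbitrary one on the removed edges.\<close>
  define D where "D = \<lparr>verts = vertices G, arcs = edges G,
      tail = (\<lambda>f. if f \<in> edges H then tail D' f else tail D0 f),
      head = (\<lambda>f. if f \<in> edges H then head D' f else head D0 f)\<rparr>"
  have D: "orientation_of D G"
    using D' D0 ends sub by (auto simp: orientation_of_def D_def)
  then have finD: "fin_digraph D" by (rule fin_digraph_orientation[OF G(1)])
  interpret D: fin_digraph D by (rule finD)
  have opt: "integrally_optimal (cycle_space D)"
    using G D opt_in_iff by blast
  have eqs: "arcs D = edges G" "arcs D' = edges H" "verts D = vertices G" "verts D' = vertices H"
    using D D' by (auto simp: orientation_of_def)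
  have "cycle_space D' = {x \<in> cycle_space D. \<forall>f\<in>edges G - edges H. x f = 0}"
  proof (rule cycle_space_deletion)
    show agree: "tail D' f = tail D f \<and> head D' f = head D f" if "f \<in> arcs D'" for f
      using that eqs by (simp add: D_def)
    show "tail D f \<in> verts D' \<and> head D f \<in> verts D'" if "f \<in> arcs D'" for f
      using agree[OF that] D'.wellformed[OF that] by simp
  qed (use eqs sub D.finite_arcs in auto)
  moreover have "finite (edges G - edges H)"
    using G(1) by (simp add: finite_graph_def)
  ultimately show "integrally_optimal (cycle_space D')"
    using integrally_optimal_deletion_set[OF _ regular_space_cycle_space[OF finD] opt] by simp
qed

lemma net_outflow_upd:
  assumes "finite (arcs D)" "e \<in> arcs D"
  shows "net_outflow D (x(e := t)) v =
    net_outflow D x v + (t - x e) * (of_bool (tail D e = v) - of_bool (head D e = v))"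
proof -
  have "(\<Sum>f\<in>arcs D - {e}. (x(e := t)) f * (of_bool (tail D f = v) - of_bool (head D f = v))) =
      (\<Sum>f\<in>arcs D - {e}. x f * (of_bool (tail D f = v) - of_bool (head D f = v)))"
    by (rule sum.cong) auto
  then show ?thesis
    unfolding net_outflow_def sum.remove[OF assms] by (simp add: algebra_simps)
qed

section \<open>The cycle space under contraction of a non-loop arc\<close>

context
  fixes D D' :: "('v, 'e) pre_digraph" and e :: 'e and w :: 'v and \<phi> :: "'v \<Rightarrow> 'v"
  assumes D: "fin_digraph D" and e: "e \<in> arcs D" "tail D e \<noteq> head D e"
    and w: "w \<notin> verts D - {tail D e, head D e}"
    and \<phi>: "\<And>z. \<phi> z = (if z = tail D e \<or> z = head D e then w else z)"
    and verts: "verts D' = insert w (verts D - {tail D e, head D e})"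
    and arcs: "arcs D' = arcs D - {e}"
    and ends: "\<And>f. f \<in> arcs D' \<Longrightarrow> tail D' f = \<phi> (tail D f) \<and> head D' f = \<phi> (head D f)"
begin

interpretation fin_digraph D by (rule D)

text \<open>The arc \<open>e\<close> contributes opposite amounts at its two ends and nothing
  elsewhere, so its value cancels whatever it is.\<close>

lemma net_outflow_contraction:
  "net_outflow D' x w = net_outflow D x (tail D e) + net_outflow D x (head D e)"
  "v \<in> verts D - {tail D e, head D e} \<Longrightarrow> net_outflow D' x v = net_outflow D x v"
proof -
  \<comment> \<open>The name \<open>w\<close> may be fresh or one of the ends of \<open>e\<close>;
    in either case exactly the two ends are the vertices sent to \<open>w\<close>.\<close>
  have "of_bool (\<phi> z = w) = (of_bool (z = tail D e) + of_bool (z = head D e) :: real)"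
    if "z \<in> verts D" for z
    using that e(2) w by (auto simp: \<phi>)
  then have "net_outflow D' x w = (\<Sum>f\<in>arcs D - {e}.
      x f * (of_bool (tail D f = tail D e) - of_bool (head D f = tail D e)) +
      x f * (of_bool (tail D f = head D e) - of_bool (head D f = head D e)))"
    unfolding net_outflow_def arcs
    by (intro sum.cong) (use ends arcs wellformed in \<open>auto simp: algebra_simps\<close>)
  then show "net_outflow D' x w = net_outflow D x (tail D e) + net_outflow D x (head D e)"
    unfolding net_outflow_def sum.remove[OF finite_arcs e(1)] using e(2) by (simp add: sum.distrib)
next
  assume v: "v \<in> verts D - {tail D e, head D e}"
  then have "\<phi> z = v \<longleftrightarrow> z = v" for z
    using w by (auto simp: \<phi>)
  then have "net_outflow D' x v =
      (\<Sum>f\<in>arcs D - {e}. x f * (of_bool (tail D f = v) - of_bool (head D f = v)))"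
    unfolding net_outflow_def arcs
    by (intro sum.cong) (use ends arcs in auto)
  then show "net_outflow D' x v = net_outflow D x v"
    unfolding net_outflow_def sum.remove[OF finite_arcs e(1)] using v by auto
qed

lemma cycle_space_contraction: "cycle_space D' = (\<lambda>x. x(e := 0)) ` cycle_space D"
proof -
  have "finite (arcs D')" using arcs by simp
  note conv = cycle_space_eq_net_outflow[OF finite_arcs] cycle_space_eq_net_outflow[OF this]
  have off_e: "net_outflow D' (x(e := t)) v = net_outflow D' x v" for x t v
    unfolding net_outflow_def arcs by (rule sum.cong) auto
  have ends_e: "tail D e \<in> verts D" "head D e \<in> verts D"
    using e(1) by simp_all
  show ?thesis
  proof (intro equalityI subsetI)
    fix x assume "x \<in> cycle_space D'"
    then have x: "supp x \<subseteq> arcs D - {e}" "\<And>v. v \<in> verts D' \<Longrightarrow> net_outflow D' x v = 0"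
      using arcs by (auto simp: conv)
    then have xe: "x e = 0" by auto
    \<comment> \<open>The lost coordinate is the flow on \<open>e\<close> that balances its tail;
      conservation at \<open>w\<close> then forces balance at its head.\<close>
    define y where "y = x(e := - net_outflow D x (tail D e))"
    have t: "net_outflow D y (tail D e) = 0"
      using e xe by (simp add: y_def net_outflow_upd)
    have "net_outflow D' y w = 0"
      using x(2) verts by (simp add: y_def off_e)
    then have h: "net_outflow D y (head D e) = 0"
      using t by (simp add: net_outflow_contraction(1))
    have "net_outflow D y v = 0" if "v \<in> verts D - {tail D e, head D e}" for v
      using net_outflow_contraction(2)[OF that, of y] x(2)[of v] that verts by (simp add: y_def off_e)
    with t h have "net_outflow D y v = 0" if "v \<in> verts D" for v
      using that by blast
    moreover have "supp y \<subseteq> arcs D"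
      using x(1) e(1) by (auto simp: y_def split: if_splits)
    ultimately have "y \<in> cycle_space D" by (simp add: conv)
    moreover have "x = y(e := 0)" using xe by (auto simp: y_def)
    ultimately show "x \<in> (\<lambda>x. x(e := 0)) ` cycle_space D" by blast
  next
    fix x assume "x \<in> (\<lambda>x. x(e := 0)) ` cycle_space D"
    then obtain y where y: "x = y(e := 0)" "y \<in> cycle_space D" by blast
    have "net_outflow D' y v = 0" if "v \<in> verts D'" for v
    proof (cases "v = w")
      case True
      then show ?thesis
        using y(2) ends_e by (simp add: net_outflow_contraction(1) conv)
    next
      case False
      then have "v \<in> verts D - {tail D e, head D e}" using that verts by simp
      then show ?thesis
        using y(2) by (simp add: net_outflow_contraction(2) conv)
    qed
    moreover have "supp x \<subseteq> arcs D'"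
      using y arcs by (auto simp: conv split: if_splits)
    ultimately show "x \<in> cycle_space D'"
      unfolding y(1) by (simp add: conv off_e)
  qed
qed

end

text \<open>Conservation at the tail of \<open>e\<close> reads \<open>x e = 0\<close>. This supplies
  the non-loop hypothesis of the contraction argument for spaces.\<close>

lemma cycle_space_supp_nonloop:
  assumes D: "fin_digraph D" and e: "e \<in> arcs D" "tail D e \<noteq> head D e"
    and x: "x \<in> cycle_space D" "supp x \<subseteq> {e}"
  shows "x = 0"
proof -
  interpret fin_digraph D by (rule D)
  have "net_outflow D x (tail D e) = 0"
    using x(1) e(1) by (simp add: cycle_space_eq_net_outflow)
  moreover have "net_outflow D x (tail D e) = x e"
  proof -
    have "(\<Sum>f\<in>arcs D - {e}. x f * (of_bool (tail D f = tail D e) - of_bool (head D f = tail D e))) = 0"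
      using x(2) by (intro sum.neutral) auto
    then show ?thesis
      unfolding net_outflow_def sum.remove[OF finite_arcs e(1)] using e(2) by simp
  qed
  ultimately show ?thesis
    using x(2) by (force simp: fun_eq_iff)
qed

lemma opt_in_contraction:
  assumes G: "finite_graph G" "opt_in G"
    and e: "e \<in> edges G" "proper_uprod (ends G e)"
    and w: "w \<notin> vertices G - set_uprod (ends G e)"
  shows "opt_in (contract_edge e w G)"
proof -
  let ?H = "contract_edge e w G"
  have H: "finite_graph ?H"
    using finite_graph_minor_step[OF edge_contraction[OF e w] G(1)] .
  define \<phi> where "\<phi> z = (if z \<in> set_uprod (ends G e) then w else z)" for z
  show ?thesis
    unfolding opt_in_iff[OF H]
  proof (intro allI impI)
    fix D' :: "('a, 'b) pre_digraph" assume D': "orientation_of D' ?H"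
    have D'_ends: "Upair (tail D' f) (head D' f) = map_uprod \<phi> (ends G f)" if "f \<in> edges G - {e}" for f
      using D' that by (simp add: orientation_of_def contract_edge_def \<phi>_def[abs_def])
    \<comment> \<open>\<open>D'\<close> determines the ends of \<open>f\<close> only after
      identification and as an unordered pair, so the ends in \<open>G\<close> are ordered to match
      \<open>D'\<close>; \<open>e\<close> itself may be oriented either way.\<close>
    have "\<exists>p. Upair (fst p) (snd p) = ends G f \<and>
        (f \<noteq> e \<longrightarrow> tail D' f = \<phi> (fst p) \<and> head D' f = \<phi> (snd p))" if f: "f \<in> edges G" for f
    proof -
      obtain a b where ab: "ends G f = Upair a b" by (cases "ends G f")
      show ?thesis
      proof (cases "f = e")
        case True
        then show ?thesis using ab by (intro exI[of _ "(a, b)"]) simp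
      next
        case False
        then have "Upair (tail D' f) (head D' f) = Upair (\<phi> a) (\<phi> b)"
          using D'_ends[of f] f ab by simp
        then have "tail D' f = \<phi> a \<and> head D' f = \<phi> b \<or> tail D' f = \<phi> b \<and> head D' f = \<phi> a"
          by auto
        then show ?thesis
        proof
          assume "tail D' f = \<phi> a \<and> head D' f = \<phi> b"
          then show ?thesis using ab by (intro exI[of _ "(a, b)"]) simp
        next
          assume "tail D' f = \<phi> b \<and> head D' f = \<phi> a"
          then show ?thesis using ab by (intro exI[of _ "(b, a)"]) auto
        qed
      qed
    qed
    then obtain t where t: "\<And>f. f \<in> edges G \<Longrightarrow> Upair (fst (t f)) (snd (t f)) = ends G f"
        "\<And>f. f \<in> edges G \<Longrightarrow> f \<noteq> e \<Longrightarrow> tail D' f = \<phi> (fst (t f)) \<and> head D' f = \<phi> (snd (t f))"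
      by metis
    define D where "D = \<lparr>verts = vertices G, arcs = edges G, tail = fst \<circ> t, head = snd \<circ> t\<rparr>"
    have D: "orientation_of D G"
      using t(1) by (simp add: orientation_of_def D_def)
    then have finD: "fin_digraph D" by (rule fin_digraph_orientation[OF G(1)])
    have opt: "integrally_optimal (cycle_space D)"
      using G D opt_in_iff by blast
    have eD: "e \<in> arcs D" using e(1) by (simp add: D_def)
    have "Upair (tail D e) (head D e) = ends G e"
      using t(1)[OF e(1)] by (simp add: D_def)
    then have set_ends: "set_uprod (ends G e) = {tail D e, head D e}"
      and "proper_uprod (Upair (tail D e) (head D e))"
      using e(2) by (metis set_uprod_simps, simp)
    then have ne: "tail D e \<noteq> head D e" by simp
    have "cycle_space D' = (\<lambda>x. x(e := 0)) ` cycle_space D"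
    proof (rule cycle_space_contraction[OF finD eD ne, where \<phi> = \<phi> and w = w])
      show "w \<notin> verts D - {tail D e, head D e}"
        using w by (simp add: set_ends D_def)
      show "\<phi> z = (if z = tail D e \<or> z = head D e then w else z)" for z
        by (simp add: \<phi>_def set_ends)
      show "verts D' = insert w (verts D - {tail D e, head D e})" "arcs D' = arcs D - {e}"
        using D' set_ends by (auto simp: orientation_of_def contract_edge_def D_def)
      show "tail D' f = \<phi> (tail D f) \<and> head D' f = \<phi> (head D f)" if "f \<in> arcs D'" for f
        using that t(2)[of f] D' by (simp add: orientation_of_def contract_edge_def D_def)
    qed
    then show "integrally_optimal (cycle_space D')"
      using integrally_optimal_contraction[OF regular_space_cycle_space[OF finD] opt, of e]
        cycle_space_supp_nonloop[OF finD eD ne] by simp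
  qed
qed

lemma opt_in_minor_step:
  assumes "minor_step G H" "finite_graph G" "opt_in G"
  shows "opt_in H"
  using assms(1)
proof cases
  case (edge_deletion e)
  then show ?thesis
    using opt_in_deletion[OF assms(2,3) finite_graph_minor_step[OF assms(1,2)]]
    by (auto simp: delete_edge_def)
next
  case (vertex_deletion v)
  then show ?thesis
    using opt_in_deletion[OF assms(2,3) finite_graph_minor_step[OF assms(1,2)]]
    by (auto simp: delete_vertex_def)
next
  case (edge_contraction e w)
  then show ?thesis
    using opt_in_contraction[OF assms(2,3)] by simp
qed

theorem theorem5p4:
  fixes G H :: "('v, 'e) multigraph"
  assumes "finite_graph G"
    and "opt_in G"
    and "minor_of H G"
  shows "opt_in H"
proof -
  have "minor_step\<^sup>*\<^sup>* G H" using assms(3) by (simp add: minor_of_def)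
  \<comment> \<open>Finiteness travels along the induction because each single step relies on
    it.\<close>
  then have "finite_graph H \<and> opt_in H"
    by induction (use assms(1,2) finite_graph_minor_step opt_in_minor_step in blast)+
  then show ?thesis ..
qed

end
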